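(* Let $\bar\gamma>0$ and $0<\beta<1$. Let $\gamma$ be the instantaneous SNR of the double-Rayleigh and LOS (DRLOS) fading channel, i.e. the normalized SOSF fading channel with parameters $(\alpha,\beta)=(1-\beta,\beta)$, with average SNR $\bar\gamma$. Then the CDF of $\gamma$ is $$F_\gamma(\gamma)=\frac{2}{\sqrt{1-\beta}}\,K_0\!\left(2\sqrt{\tfrac{\beta}{1-\beta}}\right)\sqrt{\tfrac{\gamma}{\bar \gamma}}\;I_1\!\left( 2\sqrt{\tfrac{\gamma/\bar\gamma}{1-\beta}}\right)\quad\text{for }0<\gamma<\beta\bar\gamma,$$ $$F_\gamma(\gamma)=c+\frac{2}{\sqrt{1-\beta}}\,I_0\!\left(2\sqrt{\tfrac{\beta}{1-\beta}} \right) \left[ \sqrt{\beta}\,K_1\!\left( 2\sqrt{\tfrac{\beta}{1-\beta}}\right)-\sqrt{\tfrac{\gamma}{\bar \gamma}}\,K_1\!\left(2\sqrt{\tfrac{\gamma/\bar\gamma}{1-\beta}}\right)\right]\quad\text{for }\gamma>\beta\bar\gamma,$$ where $$c=2\sqrt{\tfrac{\beta}{1-\beta}}\,K_0\!\left(2\sqrt{\tfrac{\beta}{1-\beta}}\right)I_1\!\left(2\sqrt{\tfrac{\beta}{1-\beta}}\right).$$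
   Context: SOSF (second order scattering fading) channel: $S=\omega_0e^{j\phi}+\omega_1G_1+\omega_2G_2G_3$, where $j$ is the imaginary unit, $\omega_0,\omega_1,\omega_2\ge 0$ are real constants with $\omega_0^2+\omega_1^2+\omega_2^2=1$, $\phi$ is uniform on $[0,2\pi)$, and $G_1,G_2,G_3$ are circularly-symmetric complex Gaussian random variables with mean $0$ and variance $\mathbb{E}|G_i|^2=1$; $\phi,G_1,G_2,G_3$ are mutually independent. The parameters are $\alpha=\omega_2^2$ and $\beta=\omega_0^2$ (so $\omega_1^2=1-\alpha-\beta$). The instantaneous SNR is $\gamma=\bar\gamma|S|^2$, so that $\mathbb{E}(\gamma)=\bar\gamma$. $I_\nu$ and $K_\nu$ denote the modified Bessel functions of the first and second kind of order $\nu$. *)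

theory Defs
  imports "HOL-Probability.Probability"
begin

(* Modified Bessel functions of real order, for positive argument.
   First kind: the ascending series, with 1/Gamma written as rGamma so that its zeros at
   the poles of Gamma are the intended ones.
   Second kind: the integral of exp (-x cosh t) cosh (nu t) over t >= 0, which is absolutely
   convergent for every real order nu, including the integer orders. *)

definition bessel_I :: "real \<Rightarrow> real \<Rightarrow> real" where
  "bessel_I \<nu> x = (\<Sum>k. (x / 2) powr (2 * real k + \<nu>) * rGamma (real k + \<nu> + 1) / fact k)"

definition bessel_K :: "real \<Rightarrow> real \<Rightarrow> real" where
  "bessel_K \<nu> x = (LBINT t:{0..}. exp (- x * cosh t) * cosh (\<nu> * t))"

(* v is E|Z|^2, shared equally between the independent real and imaginary parts. *)
definition circular_complex_gaussian :: "'a measure \<Rightarrow> real \<Rightarrow> ('a \<Rightarrow> complex) \<Rightarrow> bool" where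
  "circular_complex_gaussian M v Z \<longleftrightarrow>
     Z \<in> borel_measurable M \<and>
     prob_space.indep_var M borel (\<lambda>x. Re (Z x)) borel (\<lambda>x. Im (Z x)) \<and>
     distributed M lborel (\<lambda>x. Re (Z x)) (normal_density 0 (sqrt (v / 2))) \<and>
     distributed M lborel (\<lambda>x. Im (Z x)) (normal_density 0 (sqrt (v / 2)))"

(* indep_vars needs a single value type, so the real phase is embedded into the complex
   numbers; this does not change the sigma-algebra it generates. *)
locale sosf_channel = prob_space M for M :: "'a measure" +
  fixes \<omega>0 \<omega>1 \<omega>2 :: real
    and \<phi> :: "'a \<Rightarrow> real"
    and G1 G2 G3 :: "'a \<Rightarrow> complex"
  assumes weights_nonneg: "0 \<le> \<omega>0" "0 \<le> \<omega>1" "0 \<le> \<omega>2"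
    and weights_normalized: "\<omega>0\<^sup>2 + \<omega>1\<^sup>2 + \<omega>2\<^sup>2 = 1"
    and phase_measurable: "\<phi> \<in> borel_measurable M"
    and phase_uniform: "distr M lborel \<phi> = uniform_measure lborel {0..<2 * pi}"
    and gaussian: "circular_complex_gaussian M 1 G1"
                  "circular_complex_gaussian M 1 G2"
                  "circular_complex_gaussian M 1 G3"
    and independent:
      "indep_vars (\<lambda>_. borel) (\<lambda>i. [\<lambda>x. complex_of_real (\<phi> x), G1, G2, G3] ! i) {0..<4::nat}"

definition sosf_signal ::
  "real \<Rightarrow> real \<Rightarrow> real \<Rightarrow> ('a \<Rightarrow> real) \<Rightarrow> ('a \<Rightarrow> complex) \<Rightarrow> ('a \<Rightarrow> complex) \<Rightarrow> ('a \<Rightarrow> complex)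
    \<Rightarrow> 'a \<Rightarrow> complex" where
  "sosf_signal \<omega>0 \<omega>1 \<omega>2 \<phi> G1 G2 G3 x =
     of_real \<omega>0 * exp (\<i> * of_real (\<phi> x)) + of_real \<omega>1 * G1 x + of_real \<omega>2 * G2 x * G3 x"

definition instantaneous_snr :: "real \<Rightarrow> ('a \<Rightarrow> complex) \<Rightarrow> 'a \<Rightarrow> real" where
  "instantaneous_snr \<gamma>bar S x = \<gamma>bar * (cmod (S x))\<^sup>2"

definition sosf_alpha :: "real \<Rightarrow> real" where "sosf_alpha \<omega>2 = \<omega>2\<^sup>2"

definition sosf_beta :: "real \<Rightarrow> real" where "sosf_beta \<omega>0 = \<omega>0\<^sup>2"

(* Double-Rayleigh plus line of sight: the SOSF channel with (alpha, beta) = (1 - beta, beta). *)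
definition drlos_channel ::
  "'a measure \<Rightarrow> real \<Rightarrow> real \<Rightarrow> real \<Rightarrow> real \<Rightarrow> ('a \<Rightarrow> real) \<Rightarrow> ('a \<Rightarrow> complex) \<Rightarrow> ('a \<Rightarrow> complex)
    \<Rightarrow> ('a \<Rightarrow> complex) \<Rightarrow> bool" where
  "drlos_channel M \<beta> \<omega>0 \<omega>1 \<omega>2 \<phi> G1 G2 G3 \<longleftrightarrow>
     sosf_channel M \<omega>0 \<omega>1 \<omega>2 \<phi> G1 G2 G3 \<and> sosf_alpha \<omega>2 = 1 - \<beta> \<and> sosf_beta \<omega>0 = \<beta>"

end

(* Given G2, the signal is a complex Gaussian of power (1 - \<beta>) |G2|^2 around a point of modulus
   sqrt \<beta>, so the Laplace transform of |S|^2 is an explicit average over |G2|^2, which is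
   exponential.  As a function T of the squared modulus s of the mean (in units of 1 - \<beta>), this
   average solves T - (s T')' = exp (- l s).  The claimed density f is built from the two solutions
   of (s f')' = f, regular at 0 and decaying at infinity, glued at b = \<beta> / (1 - \<beta>).  Hence
   s (T f' - T' f) is an antiderivative of exp (- l s) f on each side of b, and the Wronskian
   of I and K gives the total T b.  Laplace transforms determine laws on the half-line
   (Weierstrass approximation in exp (- x)), so f is the density. *)

theory Submission
  imports Defs
begin

text \<open>The density is guessed and then verified, which avoids integrating a Rice density
  against the law of |\<open>G2\<close>|^2. The guess has a structural origin. Complex Gaussian
  noise of total power v is planar Brownian motion stopped at a time proportional to v, and an
  exponentially distributed v turns the law of the endpoint into a resolvent. In the squared modulus
  s, a quarter of the planar Laplacian acts on radial functions as f -> (s f')', so the density must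
  be the Green's function of f - (s f')' with pole at b. This explains the two formulas: f is
  continuous at b, while s f' jumps there by -1. The antiderivative s (T f' - T' f) is Lagrange's
  identity for this self-adjoint operator. Its boundary term vanishes at 0 because of the factor s,
  and at infinity because T and T' are bounded while s f and s f' tend to 0. At b the terms with T'
  cancel by continuity of f, and the jump leaves T b. Natural numbers suffice as arguments of the
  transforms, since they already give all powers of exp (- x).\<close>

section \<open>Parameter integrals\<close>

text \<open>Dominated convergence applied to the difference quotients along an arbitrary sequence.
  It serves both the integrals for K and the averaged Laplace transforms.\<close>

lemma has_real_derivative_set_integral:
  fixes f f' :: "real \<Rightarrow> 'a \<Rightarrow> real"
  assumes "0 < d"
    and int: "\<And>y. \<bar>y - x\<bar> < d \<Longrightarrow> set_integrable M S (f y)"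
    and deriv: "\<And>y t. \<bar>y - x\<bar> < d \<Longrightarrow> t \<in> S \<Longrightarrow> ((\<lambda>y. f y t) has_real_derivative f' y t) (at y)"
    and bound: "\<And>y t. \<bar>y - x\<bar> < d \<Longrightarrow> t \<in> S \<Longrightarrow> \<bar>f' y t\<bar> \<le> g t"
    and g: "set_integrable M S g"
    and meas: "set_borel_measurable M S (f' x)"
  shows "((\<lambda>y. LINT t:S|M. f y t) has_real_derivative (LINT t:S|M. f' x t)) (at x)"
  unfolding has_field_derivative_iff tendsto_at_iff_sequentially
proof (intro allI impI)
  fix X assume X: "\<forall>i. X i \<in> UNIV - {x}" "X \<longlonglongrightarrow> x"
  have "eventually (\<lambda>i. \<bar>X i - x\<bar> < d) sequentially"
    using tendstoD[OF X(2) \<open>0 < d\<close>] by (simp add: dist_real_def)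
  then obtain N where N: "\<And>i. i \<ge> N \<Longrightarrow> \<bar>X i - x\<bar> < d"
    by (auto simp: eventually_sequentially)
  \<comment> \<open>Dropping the first \<open>N\<close> terms keeps every point in the neighbourhood
    where the hypotheses hold.\<close>
  define Y where "Y i = X (i + N)" for i
  have Y: "\<bar>Y i - x\<bar> < d" "Y i \<noteq> x" for i
    using N X(1) by (auto simp: Y_def)
  have Ylim: "Y \<longlonglongrightarrow> x"
    unfolding Y_def by (rule LIMSEQ_ignore_initial_segment[OF X(2)])
  have xd: "\<bar>x - x\<bar> < d"
    using \<open>0 < d\<close> by simp
  have q: "(LINT t:S|M. f (Y i) t) - (LINT t:S|M. f x t)
      = (LINT t:S|M. f (Y i) t - f x t)" for i
    by (rule set_integral_diff(2)[symmetric]) (use int Y xd in auto)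
  have "(\<lambda>i. \<integral>t. indicator S t *\<^sub>R ((f (Y i) t - f x t) / (Y i - x)) \<partial>M)
      \<longlonglongrightarrow> (\<integral>t. indicator S t *\<^sub>R f' x t \<partial>M)"
  proof (rule integral_dominated_convergence[where w="\<lambda>t. indicator S t *\<^sub>R g t"])
    show "(\<lambda>t. indicator S t *\<^sub>R f' x t) \<in> borel_measurable M"
      using meas by (simp add: set_borel_measurable_def)
    show "integrable M (\<lambda>t. indicator S t *\<^sub>R g t)"
      using g by (simp add: set_integrable_def)
    show "(\<lambda>t. indicator S t *\<^sub>R ((f (Y i) t - f x t) / (Y i - x))) \<in> borel_measurable M" for i
    proof -
      have "set_integrable M S (\<lambda>t. (f (Y i) t - f x t) / (Y i - x))"
        by (intro set_integrable_divide set_integral_diff(1) int Y xd)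
      then show ?thesis by (auto simp: set_integrable_def)
    qed
    show "AE t in M. (\<lambda>i. indicator S t *\<^sub>R ((f (Y i) t - f x t) / (Y i - x)))
        \<longlonglongrightarrow> indicator S t *\<^sub>R f' x t"
    proof (rule AE_I2)
      fix t
      show "(\<lambda>i. indicator S t *\<^sub>R ((f (Y i) t - f x t) / (Y i - x))) \<longlonglongrightarrow> indicator S t *\<^sub>R f' x t"
      proof (cases "t \<in> S")
        case True
        have "((\<lambda>y. (f y t - f x t) / (y - x)) \<longlongrightarrow> f' x t) (at x)"
          using deriv[OF xd True] by (simp add: has_field_derivative_iff)
        then have "((\<lambda>y. (f y t - f x t) / (y - x)) \<circ> Y) \<longlonglongrightarrow> f' x t"
          unfolding tendsto_at_iff_sequentially using Y Ylim by blast
        then show ?thesis using True by (simp add: o_def)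
      qed simp
    qed
    show "AE t in M. norm (indicator S t *\<^sub>R ((f (Y i) t - f x t) / (Y i - x)))
        \<le> indicator S t *\<^sub>R g t" for i
    proof (rule AE_I2)
      fix t
      show "norm (indicator S t *\<^sub>R ((f (Y i) t - f x t) / (Y i - x))) \<le> indicator S t *\<^sub>R g t"
      proof (cases "t \<in> S")
        case True
        \<comment> \<open>The neighbourhood is convex, so the mean value inequality bounds each
          difference quotient by the bound \<open>g t\<close> on the derivative.\<close>
        have "{y. \<bar>y - x\<bar> < d} = ball x d"
          by (auto simp: dist_real_def abs_minus_commute)
        then have conv: "convex {y. \<bar>y - x\<bar> < d}"
          by simp
        have "\<bar>f (Y i) t - f x t\<bar> \<le> g t * \<bar>Y i - x\<bar>"
          unfolding real_norm_def[symmetric]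
          by (rule field_differentiable_bound[OF conv, where f'="\<lambda>y. f' y t"])
             (use Y xd True in \<open>auto intro!: DERIV_subset[OF deriv] bound\<close>)
        then show ?thesis
          using True Y(2)[of i] by (simp add: field_simps)
      qed simp
    qed
  qed
  then have "(\<lambda>i. ((LINT t:S|M. f (Y i) t) - (LINT t:S|M. f x t)) / (Y i - x))
      \<longlonglongrightarrow> (LINT t:S|M. f' x t)"
    unfolding q by (simp add: set_lebesgue_integral_def)
  then have "(\<lambda>i. (((\<lambda>y. ((LINT t:S|M. f y t) - (LINT t:S|M. f x t)) / (y - x)) \<circ> X)) (i + N))
      \<longlonglongrightarrow> (LINT t:S|M. f' x t)"
    by (simp add: Y_def o_def)
  then show "((\<lambda>y. ((LINT t:S|M. f y t) - (LINT t:S|M. f x t)) / (y - x)) \<circ> X)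
      \<longlonglongrightarrow> (LINT t:S|M. f' x t)"
    by (rule LIMSEQ_offset)
qed

text \<open>Integrability is a hypothesis here so that \<open>f\<close> may change sign, as it does
  in the identities below that integrate a total derivative.\<close>

lemma set_integral_FTC_atLeast:
  fixes f F :: "real \<Rightarrow> real"
  assumes int: "set_integrable lborel {a..} f"
    and deriv: "\<And>x. a \<le> x \<Longrightarrow> (F has_real_derivative f x) (at x)"
    and cont: "continuous_on {a..} f"
    and lim: "(F \<longlongrightarrow> L) at_top"
  shows "(LBINT x:{a..}. f x) = L - F a"
proof -
  have "((\<lambda>b. LBINT x:{a..b}. f x) \<longlongrightarrow> (LBINT x:{a..}. f x)) at_top"
    by (rule tendsto_set_lebesgue_integral_at_top[OF _ int]) auto
  moreover have "(LBINT x:{a..b}. f x) = F b - F a" if "a \<le> b" for b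
    unfolding set_lebesgue_integral_def
    by (rule integral_FTC_Icc[OF that])
       (auto simp: has_real_derivative_iff_has_vector_derivative[symmetric]
         intro!: DERIV_subset[OF deriv] continuous_on_subset[OF cont])
  then have "eventually (\<lambda>b. F b - F a = (LBINT x:{a..b}. f x)) at_top"
    by (auto intro!: eventually_at_top_linorderI[of a])
  moreover have "((\<lambda>b. F b - F a) \<longlongrightarrow> L - F a) at_top"
    by (intro tendsto_intros lim)
  ultimately show ?thesis
    using tendsto_unique[OF trivial_limit_at_top_linorder] by (blast intro: Lim_transform_eventually)
qed

lemma set_integrable_exp_neg_atLeast: "set_integrable lborel {0..} (\<lambda>v::real. exp (- v))"
proof -
  have "integrable lborel (exponential_density 1)"
    using prob_space_exponential_density[of 1]
    by (intro integrableI_nonneg)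
       (auto simp: prob_space_def prob_space_axioms_def emeasure_density less_top[symmetric])
  then show ?thesis
    unfolding set_integrable_def
    by (rule Bochner_Integration.integrable_cong[THEN iffD1, rotated -1])
       (auto simp: exponential_density_def indicator_def)
qed

lemma set_integral_exp_neg_atLeast: "(LBINT v:{0..}. exp (- v)) = (1::real)"
proof -
  have "(LBINT v:{0..}. exp (- v)) = 0 - (- exp (- 0::real))"
  proof (rule set_integral_FTC_atLeast[OF set_integrable_exp_neg_atLeast])
    show "((\<lambda>v. - exp (- v)) \<longlongrightarrow> (0::real)) at_top"
      using tendsto_minus[OF exp_at_bot[THEN filterlim_compose, OF filterlim_uminus_at_bot_at_top]]
      by simp
  qed (auto intro!: derivative_eq_intros continuous_intros)
  then show ?thesis by simp
qed

section \<open>Uniqueness of Laplace transforms\<close>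

lemma (in real_distribution) integrable_exp_neg_multiple:
  assumes "AE x in M. 0 \<le> x"
  shows "integrable M (\<lambda>x. exp (- (real n * x)))"
  using assms by (intro integrable_const_bound[of _ 1]) auto

lemma laplace_transform_cts_step_eq:
  fixes M N :: "real measure"
  assumes M: "real_distribution M" "AE x in M. 0 \<le> x"
    and N: "real_distribution N" "AE x in N. 0 \<le> x"
    and eq: "\<And>n::nat. (\<integral>x. exp (- (real n * x)) \<partial>M) = (\<integral>x. exp (- (real n * x)) \<partial>N)"
    and "a < b"
  shows "(\<integral>x. cts_step a b x \<partial>M) = (\<integral>x. cts_step a b x \<partial>N)"
proof -
  interpret M: real_distribution M by fact
  interpret N: real_distribution N by fact
  \<comment> \<open>The substitution w = exp (- x) maps the half-line onto the interval from 0 to 1,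
    open at 0. The value 0 at w = 0 stands for x at infinity, where \<open>cts_step a b\<close>
    vanishes.\<close>
  define \<psi> where "\<psi> w = (if w \<le> 0 then 0 else cts_step a b (- ln w))" for w :: real
  have cts: "continuous_on UNIV (cts_step a b)"
    using \<open>a < b\<close> by (intro uniformly_continuous_imp_continuous cts_step_uniformly_continuous)
  have "continuous_on UNIV \<psi>"
  proof (rule continuous_at_imp_continuous_on, rule ballI)
    fix w :: real
    show "isCont \<psi> w"
    proof (cases "w > 0")
      case True
      have *: "isCont (\<lambda>w. cts_step a b (- ln w)) w"
        by (rule isCont_o2[where f="\<lambda>w. - ln w" and g="cts_step a b"])
           (use cts True in \<open>simp_all add: continuous_on_eq_continuous_at isCont_ln\<close>)
      have "eventually (\<lambda>w. \<psi> w = cts_step a b (- ln w)) (nhds w)"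
        using eventually_nhds_in_open[of "{0<..}" w] True
        by (auto simp: \<psi>_def elim!: eventually_mono)
      then have "isCont \<psi> w = isCont (\<lambda>w. cts_step a b (- ln w)) w" by (rule isCont_cong)
      with * show ?thesis by simp
    next
      case False
      have "eventually (\<lambda>w. \<psi> w = 0) (nhds w)"
      proof (rule eventually_mono)
        \<comment> \<open>For 0 < w < exp (- b) one has - ln w > b, where the step function is
          already 0. So \<psi> vanishes in a whole neighbourhood of any w \<le> 0.\<close>
        show "eventually (\<lambda>y. y \<in> {..<exp (- b)}) (nhds w)"
          by (rule eventually_nhds_in_open) (use False in \<open>auto intro: le_less_trans[of _ 0]\<close>)
        fix y assume "y \<in> {..<exp (- b)}"
        then have "y > 0 \<Longrightarrow> ln y < - b" by (metis lessThan_iff ln_exp ln_less_cancel_iff exp_gt_zero)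
        then show "\<psi> y = 0" using \<open>a < b\<close> by (cases "y > 0") (auto simp: \<psi>_def cts_step_def)
      qed
      then have "isCont \<psi> w = isCont (\<lambda>_. 0::real) w"
        by (rule isCont_cong)
      then show ?thesis by simp
    qed
  qed
  then have "continuous_on {0..1} \<psi>" by (rule continuous_on_subset) auto
  \<comment> \<open>A polynomial in exp (- x) within \<open>e\<close> of the step function has the
    same integral under both measures, and each measure contributes one error
    \<open>e\<close>.\<close>
  have small: "\<bar>(\<integral>x. cts_step a b x \<partial>M) - (\<integral>x. cts_step a b x \<partial>N)\<bar> \<le> 2 * e" if "e > 0" for e
  proof -
    obtain p where p: "real_polynomial_function p" "\<And>x. x \<in> {0..1} \<Longrightarrow> \<bar>\<psi> x - p x\<bar> < e"
      using Stone_Weierstrass_real_polynomial_function[OF compact_Icc \<open>continuous_on {0..1} \<psi>\<close> \<open>e > 0\<close>]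
      by blast
    obtain c m where pc: "p = (\<lambda>x. \<Sum>i\<le>m::nat. c i * x ^ i)"
      using real_polynomial_function_imp_sum[OF p(1)] by blast
    have pexp: "p (exp (- x)) = (\<Sum>i\<le>m. c i * exp (- (real i * x)))" for x
      by (simp add: pc exp_of_nat_mult[symmetric])
    have near: "\<bar>(\<integral>x. cts_step a b x \<partial>Q) - (\<Sum>i\<le>m. c i * (\<integral>x. exp (- (real i * x)) \<partial>Q))\<bar> \<le> e"
      if Q: "real_distribution Q" "AE x in Q. 0 \<le> x" for Q
    proof -
      interpret Q: real_distribution Q by fact
      have ip: "integrable Q (\<lambda>x. exp (- (real i * x)))" for i
        by (rule Q.integrable_exp_neg_multiple[OF Q(2)])
      have ic: "integrable Q (cts_step a b)"
        using \<open>a < b\<close> by (rule Q.integrable_cts_step)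
      have "(\<integral>x. cts_step a b x \<partial>Q) - (\<Sum>i\<le>m. c i * (\<integral>x. exp (- (real i * x)) \<partial>Q))
          = (\<integral>x. cts_step a b x - p (exp (- x)) \<partial>Q)"
        using ip ic by (simp add: pexp)
      also have "\<bar>\<dots>\<bar> \<le> (\<integral>x. \<bar>cts_step a b x - p (exp (- x))\<bar> \<partial>Q)"
        by (rule integral_abs_bound)
      also have "\<dots> \<le> (\<integral>x. e \<partial>Q)"
      proof (rule integral_mono_AE)
        show "integrable Q (\<lambda>x. \<bar>cts_step a b x - p (exp (- x))\<bar>)"
          using ip ic by (simp add: pexp)
        show "AE x in Q. \<bar>cts_step a b x - p (exp (- x))\<bar> \<le> e"
          using Q(2)
        proof eventually_elim
          fix x :: real assume "0 \<le> x"
          then show "\<bar>cts_step a b x - p (exp (- x))\<bar> \<le> e"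
            using p(2)[of "exp (- x)"] by (simp add: \<psi>_def)
        qed
      qed simp
      finally show ?thesis using Q.prob_space by simp
    qed
    show ?thesis using near[OF M] near[OF N] by (simp add: eq)
  qed
  have "\<bar>(\<integral>x. cts_step a b x \<partial>M) - (\<integral>x. cts_step a b x \<partial>N)\<bar> \<le> 0"
    by (rule field_le_epsilon) (use small[of "e / 2" for e] in auto)
  then show ?thesis by simp
qed

lemma laplace_transform_unique:
  fixes M N :: "real measure"
  assumes M: "real_distribution M" "AE x in M. 0 \<le> x"
    and N: "real_distribution N" "AE x in N. 0 \<le> x"
    and eq: "\<And>n::nat. (\<integral>x. exp (- (real n * x)) \<partial>M) = (\<integral>x. exp (- (real n * x)) \<partial>N)"
  shows "M = N"
proof -
  \<comment> \<open>The step function from \<open>x\<close> to \<open>b\<close> lies between the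
    indicators of the half-lines up to \<open>x\<close> and up to \<open>b\<close>, so
    \<open>cdf P x\<close> \<le> \<open>cdf Q b\<close>. Right continuity lets \<open>b\<close>
    decrease to \<open>x\<close>, and exchanging the measures gives equality.\<close>
  have le: "cdf P x \<le> cdf Q x"
    if P: "real_distribution P" and Q: "real_distribution Q"
      and PQ: "\<And>b. x < b \<Longrightarrow> (\<integral>t. cts_step x b t \<partial>P) = (\<integral>t. cts_step x b t \<partial>Q)" for P Q x
  proof -
    interpret P: real_distribution P by fact
    interpret Q: real_distribution Q by fact
    have "(cdf Q \<longlongrightarrow> cdf Q x) (at_right x)"
      using Q.cdf_is_right_cont by (simp add: continuous_within)
    moreover have "eventually (\<lambda>b. cdf P x \<le> cdf Q b) (at_right x)"
      using eventually_at_right_less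
    proof (rule eventually_mono)
      fix b assume "x < b"
      then show "cdf P x \<le> cdf Q b"
        using P.cdf_cts_step(1)[of x b] Q.cdf_cts_step(2)[of x b] PQ[of b] by simp
    qed
    ultimately show ?thesis
      by (intro tendsto_lowerbound) auto
  qed
  note step = laplace_transform_cts_step_eq[OF M N eq]
  have "cdf M = cdf N"
    by (intro ext antisym le M N) (simp_all add: step)
  then show ?thesis by (intro cdf_unique M N)
qed

section \<open>Modified Bessel functions\<close>

text \<open>\<open>bessel_series n s\<close> is \<open>I\<^sub>n (2 \<surd>s) / (\<surd>s)\<^sup>n\<close>, which is entire in \<open>s\<close>.\<close>

definition bessel_series :: "nat \<Rightarrow> real \<Rightarrow> real" where
  "bessel_series n s = (\<Sum>k. s ^ k / (fact k * fact (k + n)))"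

lemma bessel_series_summable: "summable (\<lambda>k. 1 / (fact k * fact (k + n)) * s ^ k)" for s :: real
proof (rule summable_comparison_test[OF _ summable_exp[of "\<bar>s\<bar>"]])
  have "norm (1 / (fact k * fact (k + n)) * s ^ k) \<le> inverse (fact k) * \<bar>s\<bar> ^ k" for k
    using mult_right_mono[OF fact_ge_1[of "k + n", where 'a=real], of "fact k * \<bar>s\<bar> ^ k"]
    by (simp add: power_abs abs_mult field_simps)
  then show "\<exists>N. \<forall>k\<ge>N. norm (1 / (fact k * fact (k + n)) * s ^ k) \<le> inverse (fact k) * \<bar>s\<bar> ^ k"
    by blast
qed

lemma bessel_series_deriv:
  "(bessel_series n has_real_derivative bessel_series (Suc n) s) (at s)"
proof -
  have "((\<lambda>s. \<Sum>k. 1 / (fact k * fact (k + n)) * s ^ k) has_real_derivative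
      (\<Sum>k. diffs (\<lambda>k. 1 / (fact k * fact (k + n))) k * s ^ k)) (at s)"
    by (rule termdiffs_strong_converges_everywhere[OF bessel_series_summable])
  moreover have "diffs (\<lambda>k. 1 / (fact k * fact (k + n))) k = (1 / (fact k * fact (k + Suc n)) :: real)" for k
  proof -
    have "diffs (\<lambda>k. 1 / (fact k * fact (k + n))) k
        = (real (Suc k) / (real (Suc k) * fact k * fact (k + Suc n)))"
      by (simp only: diffs_def fact_Suc[of k] add_Suc add_Suc_right times_divide_eq_right mult_1_right)
    then show ?thesis by (simp del: of_nat_Suc fact_Suc)
  qed
  ultimately show ?thesis
    by (simp add: bessel_series_def[abs_def])
qed

lemma bessel_series_isCont [simp]: "isCont (bessel_series n) s"
  using bessel_series_deriv by (rule DERIV_isCont)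

lemma bessel_series_borel [measurable]: "bessel_series n \<in> borel_measurable borel"
  by (intro borel_measurable_continuous_onI continuous_at_imp_continuous_on) simp

lemma bessel_series_nonneg: "0 \<le> s \<Longrightarrow> 0 \<le> bessel_series n s"
  using bessel_series_summable[of n s] unfolding bessel_series_def
  by (intro suminf_nonneg) (auto simp: field_simps)

text \<open>Since differentiation raises the index, this is (s f')' = f for f =
  \<open>bessel_series 0\<close>. Over the common denominator (k+1)! (k+2)! the coefficients agree
  because k + 2 = (k + 1) + 1.\<close>

lemma bessel_series_recurrence:
  "s * bessel_series 2 s + bessel_series 1 s = bessel_series 0 s"
proof -
  let ?a = "\<lambda>n k. s ^ k / (fact k * fact (k + n)) :: real"
  have s: "summable (?a n)" for n
    using bessel_series_summable[of n s] by simp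
  have 0: "suminf (?a 0) = ?a 0 0 + (\<Sum>k. ?a 0 (Suc k))" and 1: "suminf (?a 1) = ?a 1 0 + (\<Sum>k. ?a 1 (Suc k))"
    using suminf_split_head[OF s] by (simp_all only: algebra_simps)
  have "?a 0 (Suc k) = s * ?a 2 k + ?a 1 (Suc k)" for k
    by (simp add: divide_simps numeral_2_eq_2) (simp add: algebra_simps)
  then have "(\<Sum>k. ?a 0 (Suc k)) = s * suminf (?a 2) + (\<Sum>k. ?a 1 (Suc k))"
    using suminf_add[OF summable_mult[OF s[of 2], of s] summable_ignore_initial_segment[OF s[of 1], of 1]]
      suminf_mult[OF s[of 2], of s] by simp
  then show ?thesis
    using 0 1 by (simp add: bessel_series_def)
qed

lemma bessel_I_eq_series:
  assumes "0 < s"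
  shows "bessel_I (real n) (2 * sqrt s) = sqrt s ^ n * bessel_series n s"
proof -
  have "(2 * sqrt s / 2) powr (2 * real k + real n) * rGamma (real k + real n + 1) / fact k
      = sqrt s ^ n * (s ^ k / (fact k * fact (k + n)))" for k
  proof -
    have "(2 * sqrt s / 2) powr (2 * real k + real n) = sqrt s ^ (2 * k + n)"
      using assms by (simp add: powr_realpow[symmetric])
    also have "\<dots> = s ^ k * sqrt s ^ n"
      using assms by (simp add: power_add power_mult)
    finally show ?thesis
      using Gamma_fact[of "k + n", where 'a=real] by (simp add: rGamma_inverse_Gamma field_simps add_ac)
  qed
  then have "bessel_I (real n) (2 * sqrt s) = (\<Sum>k. sqrt s ^ n * (s ^ k / (fact k * fact (k + n))))"
    by (simp only: bessel_I_def)
  also have "\<dots> = sqrt s ^ n * bessel_series n s"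
    unfolding bessel_series_def using bessel_series_summable[of n s] by (intro suminf_mult) simp
  finally show ?thesis .
qed

section \<open>Integral representation of the second kind\<close>

text \<open>The power of \<open>cosh t\<close> replaces \<open>cosh (n t)\<close>, which makes the family closed under differentiation;
  it agrees with \<open>K\<^sub>n\<close> only for \<open>n = 0, 1\<close>.\<close>

definition bessel_cosh :: "nat \<Rightarrow> real \<Rightarrow> real" where
  "bessel_cosh n x = (LBINT t:{0..}. cosh t ^ n * exp (- x * cosh t))"

lemma bessel_K_eq_cosh: "bessel_K 0 x = bessel_cosh 0 x" "bessel_K 1 x = bessel_cosh 1 x"
  by (simp_all add: bessel_K_def bessel_cosh_def mult.commute)

text \<open>A single term of the exponential series gives y^m / m! \<le> exp y at y = x cosh t. As n
  < m, one power of cosh t is left over, and cosh t \<ge> exp t / 2 converts it into the integrable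
  factor 2 exp (- t). Leaving \<open>m\<close> free allows any desired polynomial decay in
  \<open>x\<close>.\<close>

lemma cosh_power_exp_le:
  fixes t x :: real
  assumes "0 < x" "n < m"
  shows "cosh t ^ n * exp (- x * cosh t) \<le> 2 * fact m / x ^ m * exp (- t)"
proof -
  have c: "1 \<le> cosh t" "exp t / 2 \<le> cosh t"
    by (rule cosh_real_ge_1, simp add: cosh_field_def)
  have "(x * cosh t) ^ m / fact m \<le> exp (x * cosh t)"
    using sum_le_suminf[OF summable_exp[of "x * cosh t"], of "{m}"] assms
    by (simp add: exp_def divide_inverse mult.commute)
  then have "cosh t ^ m * exp (- (x * cosh t)) \<le> fact m / x ^ m"
    using assms by (simp add: exp_minus power_mult_distrib field_simps)
  moreover have "cosh t ^ Suc n * exp (- (x * cosh t)) \<le> cosh t ^ m * exp (- (x * cosh t))"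
    using c assms(2) by (intro mult_right_mono power_increasing) auto
  ultimately have "cosh t ^ Suc n * exp (- (x * cosh t)) \<le> fact m / x ^ m"
    by (rule order_trans[rotated])
  then have "cosh t * (cosh t ^ n * exp (- (x * cosh t))) \<le> fact m / x ^ m"
    by (simp add: mult.assoc)
  moreover have "exp t / 2 * (cosh t ^ n * exp (- (x * cosh t))) \<le> cosh t * (cosh t ^ n * exp (- (x * cosh t)))"
    using c by (intro mult_right_mono) auto
  ultimately have "exp t / 2 * (cosh t ^ n * exp (- (x * cosh t))) \<le> fact m / x ^ m"
    by (rule order_trans[rotated])
  then have "2 * exp (- t) * (exp t / 2 * (cosh t ^ n * exp (- (x * cosh t)))) \<le> 2 * exp (- t) * (fact m / x ^ m)"
    by (rule mult_left_mono) simp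
  moreover have "2 * exp (- t) * (exp t / 2 * y) = y" for y
    by (simp add: exp_minus)
  ultimately show ?thesis by (simp only: minus_mult_left) (simp add: mult_ac)
qed

lemma bessel_cosh_integrable:
  fixes x :: real
  assumes "0 < x"
  shows "set_integrable lborel {0..} (\<lambda>t. cosh t ^ n * exp (- x * cosh t))"
proof (rule set_integrable_bound[where f="\<lambda>t. 2 * fact (Suc n) / x ^ Suc n * exp (- t)"])
  show "set_integrable lborel {0..} (\<lambda>t. 2 * fact (Suc n) / x ^ Suc n * exp (- t))"
    by (intro set_integrable_mult_right set_integrable_exp_neg_atLeast)
  show "set_borel_measurable lborel {0..} (\<lambda>t. cosh t ^ n * exp (- x * cosh t))"
    unfolding set_borel_measurable_def by (intro borel_measurable_scaleR) (auto intro!: borel_measurable_continuous_onI continuous_intros)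
  show "AE t in lborel. t \<in> {0..} \<longrightarrow> norm (cosh t ^ n * exp (- x * cosh t))
      \<le> norm (2 * fact (Suc n) / x ^ Suc n * exp (- t))"
  proof (intro AE_I2 impI)
    fix t :: real
    show "norm (cosh t ^ n * exp (- x * cosh t)) \<le> norm (2 * fact (Suc n) / x ^ Suc n * exp (- t))"
      using order_trans[OF cosh_power_exp_le[OF assms lessI, of t n] abs_ge_self] by simp
  qed
qed

lemma bessel_cosh_nonneg: "0 \<le> bessel_cosh n x"
  unfolding bessel_cosh_def set_lebesgue_integral_def by (intro Bochner_Integration.integral_nonneg) auto

lemma bessel_cosh_le:
  assumes "0 < x" "n < m"
  shows "bessel_cosh n x \<le> 2 * fact m / x ^ m"
proof -
  have "bessel_cosh n x \<le> (LBINT t:{0..}. 2 * fact m / x ^ m * exp (- t))"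
    unfolding bessel_cosh_def using assms
    by (intro set_integral_mono bessel_cosh_integrable cosh_power_exp_le
        set_integrable_mult_right set_integrable_exp_neg_atLeast)
  then show ?thesis by (simp add: set_integral_exp_neg_atLeast)
qed

lemma bessel_cosh_deriv:
  assumes "0 < x"
  shows "(bessel_cosh n has_real_derivative - bessel_cosh (Suc n) x) (at x)"
proof -
  let ?f' = "\<lambda>y t. - (cosh t ^ Suc n * exp (- y * cosh t))"
  have "((\<lambda>y. LBINT t:{0..}. cosh t ^ n * exp (- y * cosh t)) has_real_derivative
      (LBINT t:{0..}. ?f' x t)) (at x)"
  \<comment> \<open>Radius x / 2 keeps y \<ge> x / 2 > 0, so the integrand at x / 2 dominates for
    all y nearby.\<close>
  proof (rule has_real_derivative_set_integral[where d="x / 2"])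
    show "set_integrable lborel {0..} (\<lambda>t. cosh t ^ n * exp (- y * cosh t))" if "\<bar>y - x\<bar> < x / 2" for y
      using that by (intro bessel_cosh_integrable) (auto simp: abs_if split: if_splits)
    show "((\<lambda>y. cosh t ^ n * exp (- y * cosh t)) has_real_derivative ?f' y t) (at y)" for y t
      by (auto intro!: derivative_eq_intros)
    show "\<bar>?f' y t\<bar> \<le> cosh t ^ Suc n * exp (- (x / 2) * cosh t)" if "\<bar>y - x\<bar> < x / 2" for y t
    proof -
      have "x / 2 \<le> y" using that by (auto simp: abs_if split: if_splits)
      then have "x / 2 * cosh t \<le> y * cosh t" by (intro mult_right_mono) auto
      then show ?thesis by (simp add: abs_mult)
    qed
    show "set_integrable lborel {0..} (\<lambda>t. cosh t ^ Suc n * exp (- (x / 2) * cosh t))"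
      using assms by (intro bessel_cosh_integrable) auto
    show "set_borel_measurable lborel {0..} (?f' x)"
      unfolding set_borel_measurable_def
      by (intro borel_measurable_scaleR) (auto intro!: borel_measurable_continuous_onI continuous_intros)
  qed (use assms in auto)
  then show ?thesis
    by (simp add: bessel_cosh_def[abs_def] set_lebesgue_integral_def)
qed

text \<open>The derivative of sinh t exp (- x cosh t), which vanishes at both ends of the half-line,
  has integral 0. In terms of K this is the modified Bessel equation x (K0'' - K0) = - K0'.\<close>

lemma bessel_cosh_recurrence:
  assumes "0 < x"
  shows "x * (bessel_cosh 2 x - bessel_cosh 0 x) = bessel_cosh 1 x"
proof -
  let ?g = "\<lambda>n t::real. cosh t ^ n * exp (- x * cosh t)"
  note int = bessel_cosh_integrable[OF assms]
  have "(LBINT t:{0..}. ?g 1 t - x * (?g 2 t - ?g 0 t)) = 0 - sinh 0 * exp (- x * cosh 0)"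
  proof (rule set_integral_FTC_atLeast)
    show "set_integrable lborel {0..} (\<lambda>t. ?g 1 t - x * (?g 2 t - ?g 0 t))"
      by (intro set_integral_diff(1) set_integrable_mult_right int)
    show "((\<lambda>t. sinh t * exp (- x * cosh t)) has_real_derivative ?g 1 t - x * (?g 2 t - ?g 0 t)) (at t)" for t
    proof -
      have "((\<lambda>t. sinh t * exp (- x * cosh t)) has_real_derivative
          cosh t * exp (- x * cosh t) - x * (sinh t)\<^sup>2 * exp (- x * cosh t)) (at t)"
        by (auto intro!: derivative_eq_intros simp: power2_eq_square)
      then show ?thesis by (simp add: cosh_square_eq algebra_simps)
    qed
    show "continuous_on {0..} (\<lambda>t. ?g 1 t - x * (?g 2 t - ?g 0 t))"
      by (intro continuous_intros)
    show "((\<lambda>t. sinh t * exp (- x * cosh t)) \<longlongrightarrow> 0) at_top"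
    proof (rule tendsto_sandwich[where f="\<lambda>_. 0" and h="\<lambda>t. 2 * fact 2 / x ^ 2 * exp (- t)"])
      show "eventually (\<lambda>t. 0 \<le> sinh t * exp (- x * cosh t)) at_top"
        by (rule eventually_at_top_linorderI[of 0]) simp
      show "eventually (\<lambda>t. sinh t * exp (- x * cosh t) \<le> 2 * fact 2 / x ^ 2 * exp (- t)) at_top"
      proof (rule always_eventually, rule allI)
        fix t :: real
        have "sinh t * exp (- x * cosh t) \<le> cosh t ^ 1 * exp (- x * cosh t)"
          by (intro mult_right_mono) (auto simp: sinh_le_cosh_real)
        also have "\<dots> \<le> 2 * fact 2 / x ^ 2 * exp (- t)"
          by (rule cosh_power_exp_le) (use assms in auto)
        finally show "sinh t * exp (- x * cosh t) \<le> 2 * fact 2 / x ^ 2 * exp (- t)" .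
      qed
      show "((\<lambda>t::real. 2 * fact 2 / x ^ 2 * exp (- t)) \<longlongrightarrow> 0) at_top"
        by (intro tendsto_mult_right_zero exp_at_bot[THEN filterlim_compose] filterlim_uminus_at_bot_at_top)
    qed simp
  qed
  then show ?thesis
    by (simp only: set_integral_diff(2)[OF int set_integrable_mult_right[OF set_integral_diff(1)[OF int int]]]
        set_integral_mult_right set_integral_diff(2)[OF int int] bessel_cosh_def) simp
qed

text \<open>With sinh in place of cosh the integral is exactly exp (- x) / x. The error is
  controlled by cosh t - sinh t = exp (- t), whose integral is 1. The bounds squeeze x K1(x) to 1 as
  x tends to 0, which fixes the constant of the Wronskian.\<close>

lemma bessel_cosh_1_bounds:
  assumes "0 < x"
  shows "exp (- x) \<le> x * bessel_cosh 1 x" "x * bessel_cosh 1 x \<le> exp (- x) + x"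
proof -
  let ?e = "\<lambda>t. exp (- x * cosh t)"
  have c1: "set_integrable lborel {0..} (\<lambda>t. cosh t * ?e t)"
    using bessel_cosh_integrable[OF assms, of 1] by simp
  have si: "set_integrable lborel {0..} (\<lambda>t. sinh t * ?e t)"
  proof (rule set_integrable_bound[OF c1])
    show "set_borel_measurable lborel {0..} (\<lambda>t. sinh t * ?e t)"
      unfolding set_borel_measurable_def
      by (intro borel_measurable_scaleR) (auto intro!: borel_measurable_continuous_onI continuous_intros)
    show "AE t in lborel. t \<in> {0..} \<longrightarrow> norm (sinh t * ?e t) \<le> norm (cosh t * ?e t)"
      by (intro AE_I2) (auto simp: abs_mult sinh_le_cosh_real)
  qed
  have "(LBINT t:{0..}. x * (sinh t * ?e t)) = 0 - (- exp (- x * cosh 0))"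
  proof (rule set_integral_FTC_atLeast)
    show "((\<lambda>t. - ?e t) has_real_derivative x * (sinh t * ?e t)) (at t)" for t
      by (auto intro!: derivative_eq_intros)
    have "filterlim (\<lambda>t. - x * cosh t) at_bot at_top"
      using filterlim_tendsto_neg_mult_at_bot[OF tendsto_const _ cosh_real_at_top, of "- x"] assms by simp
    then show "((\<lambda>t. - ?e t) \<longlongrightarrow> 0) at_top"
      using tendsto_minus[OF filterlim_compose[OF exp_at_bot]] by fastforce
  qed (intro si set_integrable_mult_right continuous_intros)+
  then have S: "x * (LBINT t:{0..}. sinh t * ?e t) = exp (- x)" by simp
  have "(LBINT t:{0..}. sinh t * ?e t) \<le> (LBINT t:{0..}. cosh t * ?e t)"
    by (intro set_integral_mono si c1 mult_right_mono) (auto simp: sinh_le_cosh_real)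
  then show "exp (- x) \<le> x * bessel_cosh 1 x"
    using assms by (simp add: S[symmetric] bessel_cosh_def)
  have "(LBINT t:{0..}. cosh t * ?e t) - (LBINT t:{0..}. sinh t * ?e t)
      = (LBINT t:{0..}. cosh t * ?e t - sinh t * ?e t)"
    by (rule set_integral_diff(2)[OF c1 si, symmetric])
  also have "\<dots> \<le> (LBINT t:{0..}. exp (- t))"
  proof (rule set_integral_mono)
    fix t :: real
    have "(cosh t - sinh t) * ?e t \<le> exp (- t) * 1"
      using assms by (intro mult_mono) (auto simp: cosh_minus_sinh)
    then show "cosh t * ?e t - sinh t * ?e t \<le> exp (- t)" by (simp add: algebra_simps)
  qed (intro set_integral_diff(1) c1 si set_integrable_exp_neg_atLeast)+
  finally have "x * ((LBINT t:{0..}. cosh t * ?e t) - (LBINT t:{0..}. sinh t * ?e t)) \<le> x * 1"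
    using assms by (intro mult_left_mono) (auto simp: set_integral_exp_neg_atLeast)
  then show "x * bessel_cosh 1 x \<le> exp (- x) + x"
    by (simp add: S[symmetric] bessel_cosh_def right_diff_distrib)
qed

section \<open>The second kind in the variable s, where x = 2 sqrt s\<close>

text \<open>For \<open>n = 0, 1\<close> this is \<open>2 K\<^sub>n (2 \<surd>s) / (\<surd>s)\<^sup>n\<close>.\<close>

definition macdonald :: "nat \<Rightarrow> real \<Rightarrow> real" where
  "macdonald n s = 2 * bessel_cosh n (2 * sqrt s) / sqrt s ^ n"

lemma macdonald_nonneg: "0 \<le> s \<Longrightarrow> 0 \<le> macdonald n s"
  by (simp add: macdonald_def bessel_cosh_nonneg)

lemma macdonald_borel [measurable]: "macdonald n \<in> borel_measurable borel"
proof -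
  have [measurable]: "cosh \<in> borel_measurable (borel :: real measure)"
    by (intro borel_measurable_continuous_onI continuous_intros)
  show ?thesis
    unfolding macdonald_def[abs_def] bessel_cosh_def set_lebesgue_integral_def
    by measurable
qed

lemma macdonald_0_deriv:
  assumes "0 < s"
  shows "(macdonald 0 has_real_derivative - macdonald 1 s) (at s)"
proof -
  have deriv: "((\<lambda>s. bessel_cosh 0 (2 * sqrt s)) has_real_derivative
      - bessel_cosh (Suc 0) (2 * sqrt s) * (2 * (inverse (sqrt s) / 2))) (at s)"
    by (rule DERIV_chain2[OF bessel_cosh_deriv])
       (use assms in \<open>auto intro!: derivative_eq_intros\<close>)
  have eq: "macdonald 0 = (\<lambda>s. 2 * bessel_cosh 0 (2 * sqrt s))"
    by (simp add: macdonald_def fun_eq_iff)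
  show ?thesis
    unfolding eq by (rule DERIV_cong[OF DERIV_cmult[OF deriv]]) (simp add: macdonald_def inverse_eq_divide)
qed

lemma times_macdonald_1:
  assumes "0 < s"
  shows "s * macdonald 1 s = 2 * sqrt s * bessel_cosh 1 (2 * sqrt s)"
proof -
  have "s * macdonald 1 s = 2 * (s / sqrt s) * bessel_cosh 1 (2 * sqrt s)"
    by (simp add: macdonald_def)
  then show ?thesis using assms by (simp add: real_div_sqrt)
qed

text \<open>Together with \<open>macdonald_0_deriv\<close> this is (s f')' = f for f =
  \<open>macdonald 0\<close>. It comes from (z K1(z))' = - z K0(z) at z = 2 sqrt s.\<close>

lemma times_macdonald_1_deriv:
  assumes "0 < s"
  shows "((\<lambda>s. s * macdonald 1 s) has_real_derivative - macdonald 0 s) (at s)"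
proof -
  have "((\<lambda>z. z * bessel_cosh 1 z) has_real_derivative - z * bessel_cosh 0 z) (at z)" if "0 < z" for z
    using bessel_cosh_recurrence[OF that] that
    by (auto intro!: derivative_eq_intros bessel_cosh_deriv simp: algebra_simps numeral_2_eq_2)
  then have "((\<lambda>s. 2 * sqrt s * bessel_cosh 1 (2 * sqrt s)) has_real_derivative
      - (2 * sqrt s) * bessel_cosh 0 (2 * sqrt s) * (2 * (inverse (sqrt s) / 2))) (at s)"
    by (rule DERIV_chain2) (use assms in \<open>auto intro!: derivative_eq_intros\<close>)
  then have "((\<lambda>s. 2 * sqrt s * bessel_cosh 1 (2 * sqrt s)) has_real_derivative - macdonald 0 s) (at s)"
    by (rule DERIV_cong) (use assms in \<open>simp add: macdonald_def field_simps\<close>)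
  then show ?thesis
    by (rule has_field_derivative_transform_within_open[of _ _ _ "{0<..}"])
       (use assms in \<open>simp_all add: times_macdonald_1 del: One_nat_def\<close>)
qed

lemma times_bessel_series_1_deriv:
  "((\<lambda>s. s * bessel_series 1 s) has_real_derivative bessel_series 0 s) (at s)"
  by (rule DERIV_cong[OF DERIV_mult[OF DERIV_ident bessel_series_deriv]])
     (simp add: bessel_series_recurrence[symmetric] numeral_2_eq_2)

lemma bessel_series_0_deriv: "(bessel_series 0 has_real_derivative bessel_series 1 s) (at s)"
  using bessel_series_deriv[of 0 s] by simp

text \<open>Only decay of boundary terms is needed, so a crude power suffices: m = 3 is the least
  exponent in \<open>bessel_cosh_le\<close> for which s / (sqrt s)^m tends to 0.\<close>

lemma times_macdonald_0_le:
  assumes "0 < s"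
  shows "s * macdonald 0 s \<le> 3 / sqrt s"
proof -
  have "s * macdonald 0 s = s * (2 * bessel_cosh 0 (2 * sqrt s))"
    by (simp add: macdonald_def)
  also have "\<dots> \<le> s * (2 * (2 * fact 3 / (2 * sqrt s) ^ 3))"
    using assms by (intro mult_left_mono bessel_cosh_le) auto
  also have "\<dots> = 3 * (s / sqrt s ^ 3)"
    by (simp add: fact_numeral power_mult_distrib)
  also have "s / sqrt s ^ 3 = 1 / sqrt s"
    using assms by (simp add: power3_eq_cube field_simps)
  finally show ?thesis by simp
qed

lemma times_macdonald_1_le:
  assumes "0 < s"
  shows "s * macdonald 1 s \<le> 2 / sqrt s"
proof -
  have "s * macdonald 1 s \<le> 2 * sqrt s * (2 * fact 2 / (2 * sqrt s) ^ 2)"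
    unfolding times_macdonald_1[OF assms] using assms
    by (intro mult_left_mono bessel_cosh_le) auto
  also have "\<dots> = 2 / sqrt s"
    using assms by (simp add: fact_numeral power2_eq_square field_simps)
  finally show ?thesis .
qed

lemma tendsto_zero_if_le_inverse_sqrt:
  fixes f :: "real \<Rightarrow> real"
  assumes "\<And>s. 0 < s \<Longrightarrow> 0 \<le> f s" "\<And>s. 0 < s \<Longrightarrow> f s \<le> c / sqrt s"
  shows "(f \<longlongrightarrow> 0) at_top"
proof (rule tendsto_sandwich[where f="\<lambda>_. 0" and h="\<lambda>s. c / sqrt s"])
  show "((\<lambda>s. c / sqrt s) \<longlongrightarrow> 0) at_top"
    by (intro tendsto_divide_0[OF tendsto_const] filterlim_at_top_imp_at_infinity sqrt_at_top)
  show "eventually (\<lambda>s. 0 \<le> f s) at_top" "eventually (\<lambda>s. f s \<le> c / sqrt s) at_top"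
    by (auto intro: eventually_mono[OF eventually_gt_at_top[of 0]] assms)
qed simp

lemma times_macdonald_tendsto_0:
  "((\<lambda>s. s * macdonald 0 s) \<longlongrightarrow> 0) at_top" "((\<lambda>s. s * macdonald 1 s) \<longlongrightarrow> 0) at_top"
proof -
  show "((\<lambda>s. s * macdonald 0 s) \<longlongrightarrow> 0) at_top"
    by (rule tendsto_zero_if_le_inverse_sqrt[OF _ times_macdonald_0_le]) (simp_all add: macdonald_nonneg)
  show "((\<lambda>s. s * macdonald 1 s) \<longlongrightarrow> 0) at_top"
    by (rule tendsto_zero_if_le_inverse_sqrt[OF _ times_macdonald_1_le]) (simp_all add: macdonald_nonneg)
qed

text \<open>Both factors solve (s f')' = f, so the derivative of \<open>W\<close> cancels and
  \<open>W\<close> is constant. Its value is read off at 0 from the right, where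
  \<open>s * macdonald 1 s\<close> tends to 1 and \<open>s * macdonald 0 s\<close> to 0.\<close>

lemma bessel_wronskian:
  assumes "0 < s"
  shows "s * (bessel_series 1 s * macdonald 0 s + bessel_series 0 s * macdonald 1 s) = 1"
proof -
  define W where "W s = s * bessel_series 1 s * macdonald 0 s + bessel_series 0 s * (s * macdonald 1 s)" for s
  have "(W has_real_derivative 0) (at s within {0<..})" if "0 < s" for s
    unfolding W_def[abs_def]
    by (rule DERIV_subset[OF DERIV_cong[OF DERIV_add[OF
            DERIV_mult[OF times_bessel_series_1_deriv macdonald_0_deriv]
            DERIV_mult[OF bessel_series_0_deriv times_macdonald_1_deriv]]]])
       (use that in \<open>auto simp: algebra_simps\<close>)
  then obtain C where C: "\<And>s. 0 < s \<Longrightarrow> W s = C"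
    using has_field_derivative_zero_constant[of "{0<..}" W] by auto
  have lim1: "((\<lambda>s. s * macdonald 1 s) \<longlongrightarrow> 1) (at_right 0)"
  proof (rule tendsto_sandwich)
    show "eventually (\<lambda>s. exp (- (2 * sqrt s)) \<le> s * macdonald 1 s) (at_right 0)"
      and "eventually (\<lambda>s. s * macdonald 1 s \<le> exp (- (2 * sqrt s)) + 2 * sqrt s) (at_right 0)"
      using eventually_at_right_less[of "0::real"]
      by (eventually_elim, simp add: times_macdonald_1 bessel_cosh_1_bounds del: One_nat_def)+
    have "((\<lambda>s. exp (- (2 * sqrt s))) \<longlongrightarrow> exp (- (2 * sqrt 0))) (at_right 0)"
      by (intro tendsto_intros)
    then show l: "((\<lambda>s. exp (- (2 * sqrt s))) \<longlongrightarrow> 1) (at_right 0)" by simp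
    have "((\<lambda>s. exp (- (2 * sqrt s)) + 2 * sqrt s) \<longlongrightarrow> 1 + 2 * sqrt 0) (at_right 0)"
      by (intro tendsto_intros l)
    then show "((\<lambda>s. exp (- (2 * sqrt s)) + 2 * sqrt s) \<longlongrightarrow> 1) (at_right 0)" by simp
  qed
  \<comment> \<open>As cosh t \<ge> 1, order 0 is dominated by order 1. Passing from one to the
    other in the scaling of \<open>macdonald\<close> gains a factor sqrt s, which tends to
    0.\<close>
  have lim0: "((\<lambda>s. s * macdonald 0 s) \<longlongrightarrow> 0) (at_right 0)"
  proof (rule tendsto_sandwich[where f="\<lambda>_. 0" and h="\<lambda>s. sqrt s * (s * macdonald 1 s)"])
    show "eventually (\<lambda>s. 0 \<le> s * macdonald 0 s) (at_right 0)"
      using eventually_at_right_less[of "0::real"] by eventually_elim (simp add: macdonald_nonneg)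
    show "eventually (\<lambda>s. s * macdonald 0 s \<le> sqrt s * (s * macdonald 1 s)) (at_right 0)"
      using eventually_at_right_less[of "0::real"]
    proof eventually_elim
      fix s :: real assume "0 < s"
      then have "bessel_cosh 0 (2 * sqrt s) \<le> bessel_cosh 1 (2 * sqrt s)"
        unfolding bessel_cosh_def
        by (intro set_integral_mono bessel_cosh_integrable mult_right_mono) (auto simp: cosh_real_ge_1)
      then have "2 * s * bessel_cosh 0 (2 * sqrt s) \<le> 2 * s * bessel_cosh 1 (2 * sqrt s)"
        using \<open>0 < s\<close> by (intro mult_left_mono) auto
      also have "\<dots> = sqrt s * (2 * sqrt s * bessel_cosh 1 (2 * sqrt s))"
        using \<open>0 < s\<close> by (simp add: algebra_simps)
      finally show "s * macdonald 0 s \<le> sqrt s * (s * macdonald 1 s)"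
        unfolding times_macdonald_1[OF \<open>0 < s\<close>] by (simp add: macdonald_def)
    qed
    have "((\<lambda>s. sqrt s * (s * macdonald 1 s)) \<longlongrightarrow> sqrt 0 * 1) (at_right 0)"
      by (intro tendsto_mult lim1 tendsto_intros)
    then show "((\<lambda>s. sqrt s * (s * macdonald 1 s)) \<longlongrightarrow> 0) (at_right 0)" by simp
  qed simp
  have cts: "(bessel_series n \<longlongrightarrow> bessel_series n 0) (at_right 0)" for n
    using bessel_series_isCont[where n=n and s=0] by (auto simp: isCont_def intro: tendsto_mono[OF at_le])
  have "((\<lambda>s. bessel_series 1 s * (s * macdonald 0 s) + bessel_series 0 s * (s * macdonald 1 s))
      \<longlongrightarrow> bessel_series 1 0 * 0 + bessel_series 0 0 * 1) (at_right 0)"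
    by (intro tendsto_intros cts lim0 lim1)
  moreover have "bessel_series 0 0 = 1"
    using powser_zero[of "\<lambda>k. 1 / (fact k * fact (k + 0)) :: real"] by (simp add: bessel_series_def)
  ultimately have "(W \<longlongrightarrow> 1) (at_right 0)"
    by (simp add: W_def[abs_def] mult_ac)
  moreover have "(W \<longlongrightarrow> C) (at_right 0)"
    by (rule tendsto_eventually) (auto intro: eventually_mono[OF eventually_at_right_less] C)
  ultimately have "C = 1"
    by (intro tendsto_unique[of "at_right (0::real)" W]) auto
  then show ?thesis
    using C[OF assms] by (simp add: W_def algebra_simps)
qed

section \<open>The law of the normalized SNR\<close>

text \<open>For complex Gaussian noise of total power \<open>v\<close> around a mean of squared modulus \<open>s\<close>, the Laplace
  transform of the squared modulus at \<open>l\<close> is the integrand without the weight \<open>exp (- v)\<close>, for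
  \<open>n = 0\<close>; \<open>n\<close> counts derivatives in \<open>s\<close>.\<close>

definition mixed_laplace :: "real \<Rightarrow> nat \<Rightarrow> real \<Rightarrow> real" where
  "mixed_laplace l n s =
    (LBINT v:{0..}. exp (- v) * ((- l) ^ n * (1 / (1 + l * v)) ^ Suc n * exp (- (l * s) * (1 / (1 + l * v)))))"

lemma mixed_laplace_integrand_le:
  fixes l s r v :: real
  assumes "0 \<le> l" "0 \<le> v" "- s \<le> r" "0 \<le> r"
  shows "\<bar>exp (- v) * ((- l) ^ n * (1 / (1 + l * v)) ^ Suc n * exp (- (l * s) * (1 / (1 + l * v))))\<bar>
    \<le> l ^ n * exp (l * r) * exp (- v)"
proof -
  define \<mu> where "\<mu> = 1 / (1 + l * v)"
  have "1 \<le> 1 + l * v" using assms by simp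
  then have \<mu>: "0 \<le> \<mu>" "\<mu> \<le> 1" by (simp_all add: \<mu>_def)
  have "\<bar>(- l) ^ n * \<mu> ^ Suc n * exp (- (l * s) * \<mu>)\<bar> = l ^ n * \<mu> ^ Suc n * exp (- (l * s) * \<mu>)"
    using assms \<mu> by (simp add: abs_mult power_abs)
  also have "\<dots> \<le> l ^ n * 1 * exp (l * r)"
  proof -
    have "- (l * s) * \<mu> \<le> l * r * \<mu>"
      using mult_left_mono[OF assms(3), of "l * \<mu>"] assms \<mu> by (simp add: algebra_simps)
    also have "\<dots> \<le> l * r"
      using assms \<mu> by (intro mult_left_le) auto
    finally have "exp (- (l * s) * \<mu>) \<le> exp (l * r)" by simp
    then show ?thesis
      using assms \<mu> by (intro mult_mono power_le_one) auto
  qed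
  finally have "exp (- v) * \<bar>(- l) ^ n * \<mu> ^ Suc n * exp (- (l * s) * \<mu>)\<bar> \<le> exp (- v) * (l ^ n * 1 * exp (l * r))"
    by (rule mult_left_mono) simp
  then show ?thesis
    unfolding \<mu>_def by (simp add: abs_mult algebra_simps)
qed

lemma mixed_laplace_integrable:
  fixes l s :: real
  assumes "0 \<le> l"
  shows "set_integrable lborel {0..}
    (\<lambda>v. exp (- v) * ((- l) ^ n * (1 / (1 + l * v)) ^ Suc n * exp (- (l * s) * (1 / (1 + l * v)))))"
proof (rule set_integrable_bound[where f="\<lambda>v. l ^ n * exp (l * \<bar>s\<bar>) * exp (- v)"])
  show "AE v in lborel. v \<in> {0..} \<longrightarrow>
      norm (exp (- v) * ((- l) ^ n * (1 / (1 + l * v)) ^ Suc n * exp (- (l * s) * (1 / (1 + l * v)))))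
      \<le> norm (l ^ n * exp (l * \<bar>s\<bar>) * exp (- v))"
    using mixed_laplace_integrand_le[OF assms, of _ s "\<bar>s\<bar>" n] assms
    by (intro AE_I2 impI order_trans[OF _ abs_ge_self[of "l ^ n * exp (l * \<bar>s\<bar>) * exp (- _)"], folded real_norm_def]) auto
qed (auto intro!: set_integrable_mult_right set_integrable_exp_neg_atLeast simp: set_borel_measurable_def)

lemma mixed_laplace_deriv:
  assumes "0 \<le> l"
  shows "(mixed_laplace l n has_real_derivative mixed_laplace l (Suc n) s) (at s)"
  unfolding mixed_laplace_def[abs_def]
proof (rule has_real_derivative_set_integral[where d=1 and g="\<lambda>v. l ^ Suc n * exp (l * (\<bar>s\<bar> + 1)) * exp (- v)"
      and f'="\<lambda>s v. exp (- v) * ((- l) ^ Suc n * (1 / (1 + l * v)) ^ Suc (Suc n) * exp (- (l * s) * (1 / (1 + l * v))))"])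
  show "\<bar>exp (- v) * ((- l) ^ Suc n * (1 / (1 + l * v)) ^ Suc (Suc n) * exp (- (l * y) * (1 / (1 + l * v))))\<bar>
      \<le> l ^ Suc n * exp (l * (\<bar>s\<bar> + 1)) * exp (- v)" if "\<bar>y - s\<bar> < 1" "v \<in> {0..}" for y v
    by (rule mixed_laplace_integrand_le) (use that assms in auto)
  show "((\<lambda>y. exp (- v) * ((- l) ^ n * (1 / (1 + l * v)) ^ Suc n * exp (- (l * y) * (1 / (1 + l * v)))))
      has_real_derivative
      exp (- v) * ((- l) ^ Suc n * (1 / (1 + l * v)) ^ Suc (Suc n) * exp (- (l * y) * (1 / (1 + l * v))))) (at y)"
    for y v
  proof -
    define \<mu> where "\<mu> = 1 / (1 + l * v)"
    show ?thesis
      unfolding \<mu>_def[symmetric] by (auto intro!: derivative_eq_intros)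
  qed
  show "set_borel_measurable lborel {0..} (\<lambda>v. exp (- v) *
      ((- l) ^ Suc n * (1 / (1 + l * v)) ^ Suc (Suc n) * exp (- (l * s) * (1 / (1 + l * v)))))"
    unfolding set_borel_measurable_def by measurable
qed (intro mixed_laplace_integrable set_integrable_mult_right set_integrable_exp_neg_atLeast assms zero_less_one)+

lemma mixed_laplace_bound:
  assumes "0 \<le> l" "0 \<le> s"
  shows "\<bar>mixed_laplace l n s\<bar> \<le> l ^ n"
proof -
  let ?f = "\<lambda>v. exp (- v) * ((- l) ^ n * (1 / (1 + l * v)) ^ Suc n * exp (- (l * s) * (1 / (1 + l * v))))"
  have "\<bar>mixed_laplace l n s\<bar> \<le> (LBINT v:{0..}. \<bar>?f v\<bar>)"
    unfolding mixed_laplace_def set_lebesgue_integral_def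
    by (rule order_trans[OF integral_abs_bound]) (simp add: abs_mult)
  also have "\<dots> \<le> (LBINT v:{0..}. l ^ n * exp (l * 0) * exp (- v))"
    by (intro set_integral_mono set_integrable_abs mixed_laplace_integrable mixed_laplace_integrand_le
        set_integrable_mult_right set_integrable_exp_neg_atLeast) (use assms in auto)
  finally show ?thesis by (simp add: set_integral_exp_neg_atLeast)
qed

text \<open>The Laplace transform of noise power \<open>v\<close> solves the heat equation in \<open>v\<close>; averaging over an
  exponential \<open>v\<close> turns it into the resolvent equation of the radial Laplacian.\<close>

lemma mixed_laplace_resolvent:
  assumes "0 \<le> l"
  shows "mixed_laplace l 0 s - (mixed_laplace l 1 s + s * mixed_laplace l 2 s) = exp (- (l * s))"
proof -
  let ?f = "\<lambda>n v. exp (- v) * ((- l) ^ n * (1 / (1 + l * v)) ^ Suc n * exp (- (l * s) * (1 / (1 + l * v))))"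
  \<comment> \<open>Minus the weighted transform at noise power v. Its value at v = 0, where there
    is no noise, produces the right-hand side exp (- (l * s)).\<close>
  let ?F = "\<lambda>v. - (exp (- v) * (1 / (1 + l * v) * exp (- (l * s) * (1 / (1 + l * v)))))"
  note int = mixed_laplace_integrable[OF assms]
  have pos: "1 + l * v > 0" if "0 \<le> v" for v
    using assms that by (simp add: add_pos_nonneg)
  have "(LBINT v:{0..}. ?f 0 v - (?f 1 v + s * ?f 2 v)) = 0 - ?F 0"
  proof (rule set_integral_FTC_atLeast)
    show "(?F has_real_derivative ?f 0 v - (?f 1 v + s * ?f 2 v)) (at v)" if "0 \<le> v" for v
    proof -
      define \<mu> where "\<mu> v = 1 / (1 + l * v)" for v
      have "(\<mu> has_real_derivative - l * (\<mu> v)\<^sup>2) (at v)"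
        unfolding \<mu>_def[abs_def] using pos[OF that]
        by (auto intro!: derivative_eq_intros simp: power2_eq_square)
      then show ?thesis
        unfolding \<mu>_def[symmetric]
        by (auto intro!: derivative_eq_intros simp: power2_eq_square) (simp add: algebra_simps power3_eq_cube)
    qed
    show "continuous_on {0..} (\<lambda>v. ?f 0 v - (?f 1 v + s * ?f 2 v))"
      by (intro continuous_intros ballI) (use pos in force)+
    show "(?F \<longlongrightarrow> 0) at_top"
    proof (rule Lim_null_comparison)
      show "eventually (\<lambda>v. norm (?F v) \<le> exp (l * \<bar>s\<bar>) * exp (- v)) at_top"
        using mixed_laplace_integrand_le[OF assms, of _ s "\<bar>s\<bar>" 0]
        by (intro eventually_at_top_linorderI[of 0]) auto
      show "((\<lambda>v. exp (l * \<bar>s\<bar>) * exp (- v)) \<longlongrightarrow> 0) at_top"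
        by (intro tendsto_mult_right_zero exp_at_bot[THEN filterlim_compose] filterlim_uminus_at_bot_at_top)
    qed
    show "set_integrable lborel {0..} (\<lambda>v. ?f 0 v - (?f 1 v + s * ?f 2 v))"
      by (intro set_integral_diff(1) set_integral_add(1) set_integrable_mult_right int)
  qed
  then show ?thesis
    by (simp only: set_integral_diff(2)[OF int set_integral_add(1)[OF int set_integrable_mult_right[OF int]]]
        set_integral_add(2)[OF int set_integrable_mult_right[OF int]]
        set_integral_mult_right mixed_laplace_def) simp
qed

text \<open>Here \<open>h\<close> is s j', so h' = j encodes (s j')' = j. Keeping \<open>h\<close>
  separate lets each Bessel solution supply its own closed form of s j'.\<close>

lemma mixed_laplace_antiderivative:
  assumes "0 \<le> l"
    and j: "(j has_real_derivative j') (at s)" and sj: "((\<lambda>s. h s) has_real_derivative j s) (at s)"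
    and h: "h s = s * j'"
  shows "((\<lambda>s. mixed_laplace l 0 s * h s - s * mixed_laplace l 1 s * j s)
    has_real_derivative exp (- (l * s)) * j s) (at s)"
proof -
  note T = mixed_laplace_deriv[OF assms(1), of 0 s] mixed_laplace_deriv[OF assms(1), of "Suc 0" s]
  have "exp (- (l * s)) * j s
      = (mixed_laplace l 0 s - (mixed_laplace l 1 s + s * mixed_laplace l 2 s)) * j s"
    by (simp only: mixed_laplace_resolvent[OF assms(1)])
  then show ?thesis
    using T by (auto intro!: derivative_eq_intros j sj simp: h numeral_2_eq_2 algebra_simps)
qed

section \<open>The candidate density and its transform\<close>

definition drlos_density :: "real \<Rightarrow> real \<Rightarrow> real" where
  "drlos_density b s = (if s < 0 then 0
    else if s < b then macdonald 0 b * bessel_series 0 s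
    else bessel_series 0 b * macdonald 0 s)"

lemma drlos_density_borel [measurable]: "drlos_density b \<in> borel_measurable borel"
  unfolding drlos_density_def[abs_def] by measurable

lemma drlos_density_nonneg: "0 < b \<Longrightarrow> 0 \<le> drlos_density b s"
  by (auto simp: drlos_density_def bessel_series_nonneg macdonald_nonneg)

lemma drlos_density_laplace:
  assumes "0 \<le> l" "0 < b"
  shows "(\<integral>\<^sup>+s. ennreal (exp (- (l * s)) * drlos_density b s) \<partial>lborel) = ennreal (mixed_laplace l 0 b)"
proof -
  let ?T = "mixed_laplace l"
  let ?i = "\<lambda>s. exp (- (l * s)) * bessel_series 0 s" and ?k = "\<lambda>s. exp (- (l * s)) * macdonald 0 s"
  let ?I = "\<lambda>s. ?T 0 s * (s * bessel_series 1 s) - s * ?T 1 s * bessel_series 0 s"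
  let ?K = "\<lambda>s. ?T 0 s * (- (s * macdonald 1 s)) - s * ?T 1 s * macdonald 0 s"
  have dI: "(?I has_real_derivative ?i s) (at s)" for s
    by (rule mixed_laplace_antiderivative[OF assms(1) bessel_series_0_deriv times_bessel_series_1_deriv]) simp
  have dK: "(?K has_real_derivative ?k s) (at s)" if "0 < s" for s
    by (rule mixed_laplace_antiderivative[OF assms(1) macdonald_0_deriv[OF that]])
       (use DERIV_minus[OF times_macdonald_1_deriv[OF that]] in simp_all)
  have nonneg: "0 \<le> ?k s" if "b \<le> s" for s
    using that assms by (auto intro!: mult_nonneg_nonneg macdonald_nonneg)
  have lim: "(?K \<longlongrightarrow> 0) at_top"
  proof -
    have "((\<lambda>s. (s * macdonald m s) * ?T n s) \<longlongrightarrow> 0) at_top" if "m = 0 \<or> m = 1" for m n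
    proof (rule Lim_null_comparison)
      show "eventually (\<lambda>s. norm ((s * macdonald m s) * ?T n s) \<le> l ^ n * (s * macdonald m s)) at_top"
      proof (rule eventually_at_top_linorderI[of 0])
        fix s :: real assume "0 \<le> s"
        then show "norm ((s * macdonald m s) * ?T n s) \<le> l ^ n * (s * macdonald m s)"
          using mult_right_mono[OF mixed_laplace_bound[OF assms(1), of s n], of "s * macdonald m s"]
          by (simp add: abs_mult macdonald_nonneg mult_ac)
      qed
      show "((\<lambda>s. l ^ n * (s * macdonald m s)) \<longlongrightarrow> 0) at_top"
        using that times_macdonald_tendsto_0 by (auto intro!: tendsto_mult_right_zero)
    qed
    note zero = this
    have eq: "?K = (\<lambda>s. - ((s * macdonald 1 s) * ?T 0 s) - (s * macdonald 0 s) * ?T 1 s)"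
      by (rule ext) (simp add: algebra_simps)
    show ?thesis
      unfolding eq using tendsto_diff[OF tendsto_minus[OF zero[of 1 0]] zero[of 0 1]] by simp
  qed
  \<comment> \<open>\<open>?K\<close> increases to its limit 0. The sign is needed because sums of
    extended nonnegative reals match real sums only for nonnegative terms.\<close>
  have Kb: "?K b \<le> 0"
  proof (rule tendsto_lowerbound[OF lim])
    show "eventually (\<lambda>s. ?K b \<le> ?K s) at_top"
    proof (rule eventually_at_top_linorderI)
      fix s assume "b \<le> s"
      then show "?K b \<le> ?K s"
      proof (rule DERIV_nonneg_imp_nondecreasing)
        fix x assume "b \<le> x"
        then have "(?K has_real_derivative ?k x) (at x)" "0 \<le> ?k x"
          using dK nonneg assms by simp_all
        then show "\<exists>y. (?K has_real_derivative y) (at x) \<and> 0 \<le> y" by blast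
      qed
    qed
  qed simp
  have lower: "(\<integral>\<^sup>+s. ennreal (?i s) * indicator {0..b} s \<partial>lborel) = ennreal (?I b)"
    by (subst nn_integral_FTC_Icc[OF _ dI]) (use assms in \<open>auto intro!: mult_nonneg_nonneg bessel_series_nonneg\<close>)
  have upper: "(\<integral>\<^sup>+s. ennreal (?k s) * indicator {b..} s \<partial>lborel) = ennreal (0 - ?K b)"
    by (rule nn_integral_FTC_atLeast[OF _ dK nonneg lim]) (use assms in auto)
  have Ib: "0 \<le> ?I b"
  proof -
    have "?I 0 \<le> ?I b"
    proof (rule DERIV_nonneg_imp_nondecreasing[where f="?I" and a=0 and b=b])
      fix x :: real assume "0 \<le> x"
      then have "0 \<le> ?i x" by (simp add: bessel_series_nonneg)
      with dI show "\<exists>y. (?I has_real_derivative y) (at x) \<and> 0 \<le> y" by blast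
    qed (use assms in simp)
    then show ?thesis by simp
  qed
  have "(\<integral>\<^sup>+s. ennreal (exp (- (l * s)) * drlos_density b s) \<partial>lborel)
      = (\<integral>\<^sup>+s. ennreal (macdonald 0 b) * (ennreal (?i s) * indicator {0..b} s)
          + ennreal (bessel_series 0 b) * (ennreal (?k s) * indicator {b..} s) \<partial>lborel)"
  \<comment> \<open>The closed pieces overlap at the single point b, a null set.\<close>
  proof (rule nn_integral_cong_AE)
    show "AE s in lborel. ennreal (exp (- (l * s)) * drlos_density b s)
        = ennreal (macdonald 0 b) * (ennreal (?i s) * indicator {0..b} s)
          + ennreal (bessel_series 0 b) * (ennreal (?k s) * indicator {b..} s)"
      using AE_lborel_singleton[of b]
    proof eventually_elim
      fix s assume "s \<noteq> b"
      then show "ennreal (exp (- (l * s)) * drlos_density b s)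
        = ennreal (macdonald 0 b) * (ennreal (?i s) * indicator {0..b} s)
          + ennreal (bessel_series 0 b) * (ennreal (?k s) * indicator {b..} s)"
        using assms
        by (auto simp: drlos_density_def indicator_def ennreal_mult'[symmetric] macdonald_nonneg
            bessel_series_nonneg mult_ac)
    qed
  qed
  also have "\<dots> = ennreal (macdonald 0 b) * ennreal (?I b) + ennreal (bessel_series 0 b) * ennreal (- ?K b)"
    using lower upper by (simp add: nn_integral_add nn_integral_cmult)
  also have "\<dots> = ennreal (macdonald 0 b * ?I b + bessel_series 0 b * (- ?K b))"
  proof -
    have combine: "ennreal p * ennreal x + ennreal q * ennreal y = ennreal (p * x + q * y)"
      if "0 \<le> p" "0 \<le> q" "0 \<le> x" "0 \<le> y" for p q x y
      using that by (simp add: ennreal_mult'[symmetric] ennreal_plus[symmetric] del: ennreal_plus)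
    show ?thesis
      by (rule combine) (use assms Ib Kb in \<open>simp_all only: macdonald_nonneg bessel_series_nonneg less_imp_le neg_0_le_iff_le\<close>)
  qed
  \<comment> \<open>The two terms with \<open>?T 1 b\<close> cancel, and \<open>?T 0 b\<close> is
    left with the Wronskian as its factor.\<close>
  also have "macdonald 0 b * ?I b + bessel_series 0 b * (- ?K b)
      = ?T 0 b * (b * (bessel_series 1 b * macdonald 0 b + bessel_series 0 b * macdonald 1 b))"
    by (simp add: algebra_simps)
  also have "\<dots> = ?T 0 b"
    by (simp only: bessel_wronskian[OF assms(2)] mult_1_right)
  finally show ?thesis .
qed

definition drlos_law :: "real \<Rightarrow> real measure" where
  "drlos_law b = density lborel (drlos_density b)"

lemma mixed_laplace_0: "mixed_laplace 0 0 s = 1"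
  by (simp add: mixed_laplace_def set_integral_exp_neg_atLeast)

text \<open>The total mass is the transform at l = 0.\<close>

lemma drlos_law_real_distribution:
  assumes "0 < b"
  shows "real_distribution (drlos_law b)"
proof -
  have "emeasure (drlos_law b) UNIV = 1"
    using drlos_density_laplace[of 0 b] assms
    by (simp add: drlos_law_def emeasure_density mixed_laplace_0)
  then show ?thesis
    by (intro real_distribution.intro prob_spaceI real_distribution_axioms.intro) (simp_all add: drlos_law_def)
qed

lemma drlos_law_AE_nonneg: "AE s in drlos_law b. 0 \<le> s"
  unfolding drlos_law_def by (subst AE_density) (auto simp: drlos_density_def)

lemma drlos_law_laplace:
  assumes "0 \<le> l" "0 < b"
  shows "(\<integral>\<^sup>+s. ennreal (exp (- (l * s))) \<partial>drlos_law b) = ennreal (mixed_laplace l 0 b)"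
  unfolding drlos_law_def drlos_density_laplace[OF assms, symmetric]
  using assms by (subst nn_integral_density)
    (auto simp: ennreal_mult'[symmetric] drlos_density_nonneg mult.commute)

text \<open>The equation (s f')' = f makes s f' an antiderivative of each branch, which is why the
  CDF involves Bessel functions of order 1.\<close>

lemma drlos_law_cdf:
  assumes "0 < b" "0 \<le> u"
  shows "u < b \<Longrightarrow> cdf (drlos_law b) u = macdonald 0 b * (u * bessel_series 1 u)"
    and "b \<le> u \<Longrightarrow> cdf (drlos_law b) u = macdonald 0 b * (b * bessel_series 1 b)
      + bessel_series 0 b * (b * macdonald 1 b - u * macdonald 1 u)"
proof -
  have em: "emeasure (drlos_law b) {..u} = (\<integral>\<^sup>+s. ennreal (drlos_density b s) * indicator {..u} s \<partial>lborel)"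
    by (simp add: drlos_law_def emeasure_density)
  have dI: "(\<integral>\<^sup>+s. ennreal (bessel_series 0 s) * indicator {0..x} s \<partial>lborel) = ennreal (x * bessel_series 1 x)"
    if "0 \<le> x" for x
    by (subst nn_integral_FTC_Icc[OF _ times_bessel_series_1_deriv]) (use that in \<open>auto intro!: bessel_series_nonneg\<close>)
  have dK: "((\<lambda>s. - (s * macdonald 1 s)) has_real_derivative macdonald 0 s) (at s)" if "s \<in> {b..u}" for s
    using DERIV_minus[OF times_macdonald_1_deriv[of s]] that assms by simp
  show "cdf (drlos_law b) u = macdonald 0 b * (u * bessel_series 1 u)" if "u < b"
  proof -
    have "emeasure (drlos_law b) {..u}
        = (\<integral>\<^sup>+s. ennreal (macdonald 0 b) * (ennreal (bessel_series 0 s) * indicator {0..u} s) \<partial>lborel)"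
      unfolding em using that assms
      by (intro nn_integral_cong)
         (auto simp: drlos_density_def indicator_def ennreal_mult' macdonald_nonneg)
    also have "\<dots> = ennreal (macdonald 0 b * (u * bessel_series 1 u))"
      using assms by (simp add: nn_integral_cmult dI ennreal_mult' macdonald_nonneg)
    finally show ?thesis
      using assms by (simp add: cdf_def measure_def macdonald_nonneg bessel_series_nonneg)
  qed
  show "cdf (drlos_law b) u = macdonald 0 b * (b * bessel_series 1 b)
      + bessel_series 0 b * (b * macdonald 1 b - u * macdonald 1 u)" if "b \<le> u"
  proof -
    have upper: "(\<integral>\<^sup>+s. ennreal (macdonald 0 s) * indicator {b..u} s \<partial>lborel)
        = ennreal (b * macdonald 1 b - u * macdonald 1 u)"
      by (subst nn_integral_FTC_Icc[OF _ dK]) (use that assms in \<open>auto intro!: macdonald_nonneg\<close>)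
    have le: "u * macdonald 1 u \<le> b * macdonald 1 b"
      using DERIV_nonneg_imp_nondecreasing[OF that, of "\<lambda>s. - (s * macdonald 1 s)"] dK macdonald_nonneg assms
      by fastforce
    have "emeasure (drlos_law b) {..u}
        = (\<integral>\<^sup>+s. ennreal (macdonald 0 b) * (ennreal (bessel_series 0 s) * indicator {0..b} s)
          + ennreal (bessel_series 0 b) * (ennreal (macdonald 0 s) * indicator {b..u} s) \<partial>lborel)"
      unfolding em
    proof (rule nn_integral_cong_AE)
      show "AE s in lborel. ennreal (drlos_density b s) * indicator {..u} s
          = ennreal (macdonald 0 b) * (ennreal (bessel_series 0 s) * indicator {0..b} s)
            + ennreal (bessel_series 0 b) * (ennreal (macdonald 0 s) * indicator {b..u} s)"
        using AE_lborel_singleton[of b]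
      proof eventually_elim
        fix s assume "s \<noteq> b"
        then show "ennreal (drlos_density b s) * indicator {..u} s
            = ennreal (macdonald 0 b) * (ennreal (bessel_series 0 s) * indicator {0..b} s)
            + ennreal (bessel_series 0 b) * (ennreal (macdonald 0 s) * indicator {b..u} s)"
          using assms that
          by (auto simp: drlos_density_def indicator_def ennreal_mult' macdonald_nonneg bessel_series_nonneg)
      qed
    qed
    also have "\<dots> = ennreal (macdonald 0 b * (b * bessel_series 1 b)
        + bessel_series 0 b * (b * macdonald 1 b - u * macdonald 1 u))"
      using assms le upper
      by (simp add: nn_integral_add nn_integral_cmult dI ennreal_mult' macdonald_nonneg bessel_series_nonneg)
    finally show ?thesis
      using assms le
      by (simp add: cdf_def measure_def macdonald_nonneg bessel_series_nonneg del: ennreal_plus)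
  qed
qed

section \<open>Laplace transforms of Gaussian channels\<close>

text \<open>Completing the square: variance 1/2 contributes the exponent - x^2, so the product is a
  multiple \<open>C\<close> of a normal density with mean \<open>m\<close> and variance 1 / (2 (1 +
  A)).\<close>

lemma nn_integral_normal_exp_quadratic:
  fixes A B :: real
  assumes "0 \<le> A"
  shows "(\<integral>\<^sup>+x. ennreal (exp (- (A * x\<^sup>2 + B * x))) \<partial>density lborel (normal_density 0 (sqrt (1 / 2))))
    = ennreal (exp (B\<^sup>2 / (4 * (1 + A))) / sqrt (1 + A))"
proof -
  define \<sigma> where "\<sigma> = sqrt (1 / (2 * (1 + A)))"
  define m where "m = - B / (2 * (1 + A))"
  define C where "C = exp (B\<^sup>2 / (4 * (1 + A))) / sqrt (1 + A)"
  have \<sigma>: "0 < \<sigma>" "\<sigma>\<^sup>2 = 1 / (2 * (1 + A))" and C: "0 \<le> C"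
    using assms by (simp_all add: \<sigma>_def C_def)
  have eq: "normal_density 0 (sqrt (1 / 2)) x * exp (- (A * x\<^sup>2 + B * x)) = C * normal_density m \<sigma> x" for x
  proof -
    have "- (x\<^sup>2) - (A * x\<^sup>2 + B * x) = B\<^sup>2 / (4 * (1 + A)) - (1 + A) * (x - m)\<^sup>2"
      using assms by (simp add: m_def power2_eq_square field_simps add_nonneg_eq_0_iff)
    then have "exp (- (x\<^sup>2)) * exp (- (A * x\<^sup>2 + B * x))
        = exp (B\<^sup>2 / (4 * (1 + A))) * exp (- ((1 + A) * (x - m)\<^sup>2))"
      by (simp add: exp_add[symmetric])
    moreover have "sqrt (pi / (1 + A)) = sqrt pi / sqrt (1 + A)"
      by (simp add: real_sqrt_divide)
    moreover have "(x - m)\<^sup>2 / (2 * \<sigma>\<^sup>2) = (1 + A) * (x - m)\<^sup>2"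
      using assms by (simp add: \<sigma>)
    moreover have "2 * pi * \<sigma>\<^sup>2 = pi / (1 + A)"
      by (simp only: \<sigma>) (use assms in \<open>simp add: divide_simps add_nonneg_eq_0_iff\<close>)
    ultimately show ?thesis
      using assms by (simp add: normal_density_def C_def)
  qed
  have "(\<integral>\<^sup>+x. ennreal (exp (- (A * x\<^sup>2 + B * x))) \<partial>density lborel (normal_density 0 (sqrt (1 / 2))))
      = (\<integral>\<^sup>+x. ennreal (normal_density 0 (sqrt (1 / 2)) x) * ennreal (exp (- (A * x\<^sup>2 + B * x))) \<partial>lborel)"
    by (rule nn_integral_density) simp_all
  also have "\<dots> = (\<integral>\<^sup>+x. ennreal C * ennreal (normal_density m \<sigma> x) \<partial>lborel)"
    by (simp only: ennreal_mult'[symmetric] normal_density_nonneg C eq)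
  also have "\<dots> = ennreal C * (\<integral>\<^sup>+x. ennreal (normal_density m \<sigma> x) \<partial>lborel)"
    by (rule nn_integral_cmult) simp
  also have "(\<integral>\<^sup>+x. ennreal (normal_density m \<sigma> x) \<partial>lborel) = 1"
    using \<sigma>(1) by (subst nn_integral_eq_integral) auto
  finally show ?thesis by (simp add: C_def)
qed

text \<open>Fubini with both integrals taken over the original space, so that one variable can be
  frozen while the other is averaged.\<close>

lemma (in prob_space) indep_var_nn_integral_iterated:
  assumes "indep_var S X T Y" and [measurable]: "h \<in> borel_measurable (S \<Otimes>\<^sub>M T)"
  shows "(\<integral>\<^sup>+\<omega>. h (X \<omega>, Y \<omega>) \<partial>M) = (\<integral>\<^sup>+\<omega>. \<integral>\<^sup>+\<omega>'. h (X \<omega>, Y \<omega>') \<partial>M \<partial>M)"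
proof -
  have [measurable]: "X \<in> measurable M S" "Y \<in> measurable M T"
    and eq: "distr M S X \<Otimes>\<^sub>M distr M T Y = distr M (S \<Otimes>\<^sub>M T) (\<lambda>x. (X x, Y x))"
    using assms(1) by (auto simp: indep_var_distribution_eq)
  interpret Y: prob_space "distr M T Y" by (rule prob_space_distr) simp
  have "(\<integral>\<^sup>+\<omega>. h (X \<omega>, Y \<omega>) \<partial>M) = (\<integral>\<^sup>+z. h z \<partial>(distr M S X \<Otimes>\<^sub>M distr M T Y))"
    unfolding eq by (simp add: nn_integral_distr)
  also have "\<dots> = (\<integral>\<^sup>+x. \<integral>\<^sup>+y. h (x, y) \<partial>distr M T Y \<partial>distr M S X)"
    by (rule Y.nn_integral_fst[symmetric]) simp
  also have "\<dots> = (\<integral>\<^sup>+\<omega>. \<integral>\<^sup>+y. h (X \<omega>, y) \<partial>distr M T Y \<partial>M)"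
    by (rule nn_integral_distr) simp_all
  also have "\<dots> = (\<integral>\<^sup>+\<omega>. \<integral>\<^sup>+\<omega>'. h (X \<omega>, Y \<omega>') \<partial>M \<partial>M)"
  proof (rule nn_integral_cong)
    fix \<omega> assume "\<omega> \<in> space M"
    then have [measurable]: "X \<omega> \<in> space S" using measurable_space[OF \<open>X \<in> measurable M S\<close>] by simp
    show "(\<integral>\<^sup>+y. h (X \<omega>, y) \<partial>distr M T Y) = (\<integral>\<^sup>+\<omega>'. h (X \<omega>, Y \<omega>') \<partial>M)"
      by (rule nn_integral_distr) simp_all
  qed
  finally show ?thesis .
qed

lemma (in prob_space) circular_complex_gaussian_laplace:
  fixes c d :: complex
  assumes Z: "circular_complex_gaussian M 1 Z" and "0 \<le> l"
  shows "(\<integral>\<^sup>+\<omega>. ennreal (exp (- (l * (cmod (c + d * Z \<omega>))\<^sup>2))) \<partial>M)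
    = ennreal (exp (- (l * (cmod c)\<^sup>2 / (1 + l * (cmod d)\<^sup>2))) / (1 + l * (cmod d)\<^sup>2))"
proof -
  define A where "A = l * (cmod d)\<^sup>2"
  \<comment> \<open>Up to sign, \<open>p\<close> and \<open>q\<close> are 2 l times the real and
    imaginary parts of cnj c * d. Hence p^2 + q^2 depends only on the moduli, which is the circular
    symmetry.\<close>
  define p where "p = 2 * l * (Re c * Re d + Im c * Im d)"
  define q where "q = 2 * l * (Im c * Re d - Re c * Im d)"
  have A: "0 \<le> A" using assms by (simp add: A_def)
  let ?N = "density lborel (normal_density 0 (sqrt (1 / 2)))"
  have ind: "indep_var borel (\<lambda>\<omega>. Re (Z \<omega>)) borel (\<lambda>\<omega>. Im (Z \<omega>))"
    and [measurable]: "Z \<in> borel_measurable M"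
    and re: "distr M lborel (\<lambda>\<omega>. Re (Z \<omega>)) = ?N" and im: "distr M lborel (\<lambda>\<omega>. Im (Z \<omega>)) = ?N"
    using Z by (auto simp: circular_complex_gaussian_def distributed_distr_eq_density)
  define E where "E B y = exp (- (A * y\<^sup>2 + B * y))" for B y
  have [measurable]: "E B \<in> borel_measurable borel" and E_nonneg: "0 \<le> E B y" for B y
    unfolding E_def[abs_def] by simp_all
  have one: "(\<integral>\<^sup>+\<omega>. ennreal (E B (X \<omega>)) \<partial>M) = ennreal (exp (B\<^sup>2 / (4 * (1 + A))) / sqrt (1 + A))"
    if "distr M lborel X = ?N" "X \<in> borel_measurable M" for X B
  proof -
    have "(\<integral>\<^sup>+\<omega>. ennreal (E B (X \<omega>)) \<partial>M) = (\<integral>\<^sup>+x. ennreal (E B x) \<partial>distr M lborel X)"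
      by (rule nn_integral_distr[symmetric]) (use that(2) in simp_all)
    then show ?thesis
      unfolding that(1) E_def nn_integral_normal_exp_quadratic[OF A] .
  qed
  define h where "h z = ennreal (exp (- (l * (cmod c)\<^sup>2))) * (ennreal (E p (fst z)) * ennreal (E q (snd z)))"
    for z :: "real \<times> real"
  have expand: "exp (- (l * (cmod (c + d * Z \<omega>))\<^sup>2)) = exp (- (l * (cmod c)\<^sup>2))
      * (E p (Re (Z \<omega>)) * E q (Im (Z \<omega>)))" for \<omega>
    unfolding E_def exp_add[symmetric] A_def p_def q_def cmod_power2
    by (simp add: algebra_simps power2_eq_square)
  have "(\<integral>\<^sup>+\<omega>. ennreal (exp (- (l * (cmod (c + d * Z \<omega>))\<^sup>2))) \<partial>M) = (\<integral>\<^sup>+\<omega>. h (Re (Z \<omega>), Im (Z \<omega>)) \<partial>M)"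
    by (simp add: expand h_def ennreal_mult' E_nonneg)
  also have "\<dots> = (\<integral>\<^sup>+\<omega>. \<integral>\<^sup>+\<omega>'. h (Re (Z \<omega>), Im (Z \<omega>')) \<partial>M \<partial>M)"
    by (rule indep_var_nn_integral_iterated[OF ind]) (simp add: h_def[abs_def])
  also have "\<dots> = ennreal (exp (- (l * (cmod c)\<^sup>2))) * (ennreal (exp (p\<^sup>2 / (4 * (1 + A))) / sqrt (1 + A))
      * ennreal (exp (q\<^sup>2 / (4 * (1 + A))) / sqrt (1 + A)))"
  proof -
    have "(\<integral>\<^sup>+\<omega>. \<integral>\<^sup>+\<omega>'. h (Re (Z \<omega>), Im (Z \<omega>')) \<partial>M \<partial>M) = ennreal (exp (- (l * (cmod c)\<^sup>2)))
        * ((\<integral>\<^sup>+\<omega>. ennreal (E p (Re (Z \<omega>))) \<partial>M) * (\<integral>\<^sup>+\<omega>. ennreal (E q (Im (Z \<omega>))) \<partial>M))"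
      by (simp add: h_def nn_integral_cmult nn_integral_multc)
    moreover have "(\<integral>\<^sup>+\<omega>. ennreal (E p (Re (Z \<omega>))) \<partial>M) = ennreal (exp (p\<^sup>2 / (4 * (1 + A))) / sqrt (1 + A))"
      and "(\<integral>\<^sup>+\<omega>. ennreal (E q (Im (Z \<omega>))) \<partial>M) = ennreal (exp (q\<^sup>2 / (4 * (1 + A))) / sqrt (1 + A))"
      by (rule one[OF re] one[OF im]; simp)+
    ultimately show ?thesis by (simp only:)
  qed
  also have "\<dots> = ennreal (exp (- (l * (cmod c)\<^sup>2)) * (exp (p\<^sup>2 / (4 * (1 + A))) / sqrt (1 + A)
      * (exp (q\<^sup>2 / (4 * (1 + A))) / sqrt (1 + A))))"
  proof -
    have "0 \<le> exp (p\<^sup>2 / (4 * (1 + A))) / sqrt (1 + A)" using A by simp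
    then show ?thesis by (simp only: ennreal_mult' exp_ge_zero)
  qed
  also have "exp (- (l * (cmod c)\<^sup>2)) * (exp (p\<^sup>2 / (4 * (1 + A))) / sqrt (1 + A)
      * (exp (q\<^sup>2 / (4 * (1 + A))) / sqrt (1 + A)))
      = exp (- (l * (cmod c)\<^sup>2) + (p\<^sup>2 + q\<^sup>2) / (4 * (1 + A))) / (1 + A)"
  proof -
    have "sqrt (1 + A) * sqrt (1 + A) = 1 + A" using A by simp
    moreover have "e * (P / r * (Q / r)) = e * (P * Q) / (r * r)" for e P Q r :: real
      by simp
    ultimately show ?thesis
      by (simp only: add_divide_distrib exp_add)
  qed
  also have "p\<^sup>2 + q\<^sup>2 = 4 * l * A * (cmod c)\<^sup>2"
    unfolding A_def p_def q_def cmod_power2 by (simp add: algebra_simps power2_eq_square)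
  also have "- (l * (cmod c)\<^sup>2) + 4 * l * A * (cmod c)\<^sup>2 / (4 * (1 + A)) = - (l * (cmod c)\<^sup>2 / (1 + A))"
    using A by (simp add: field_simps add_nonneg_eq_0_iff)
  finally show ?thesis by (simp add: A_def)
qed

section \<open>Exponential law of the Gaussian power\<close>

lemma laplace_transform_unique_nn_integral:
  fixes M N :: "real measure"
  assumes M: "real_distribution M" "AE x in M. 0 \<le> x"
    and N: "real_distribution N" "AE x in N. 0 \<le> x"
    and eq: "\<And>n::nat. (\<integral>\<^sup>+x. ennreal (exp (- (real n * x))) \<partial>M) = (\<integral>\<^sup>+x. ennreal (exp (- (real n * x))) \<partial>N)"
  shows "M = N"
proof (rule laplace_transform_unique[OF M N])
  have [measurable_cong]: "sets M = sets borel" "sets N = sets borel"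
    using M(1) N(1) by (auto simp: real_distribution_def real_distribution_axioms_def)
  show "(\<integral>x. exp (- (real n * x)) \<partial>M) = (\<integral>x. exp (- (real n * x)) \<partial>N)" for n :: nat
    by (simp add: integral_eq_nn_integral eq)
qed

lemma nn_integral_exponential:
  assumes [measurable]: "h \<in> borel_measurable borel" and nonneg: "\<And>v. 0 \<le> v \<Longrightarrow> 0 \<le> h v"
    and int: "set_integrable lborel {0..} (\<lambda>v. exp (- v) * h v)"
  shows "(\<integral>\<^sup>+v. ennreal (h v) \<partial>density lborel (exponential_density 1)) = ennreal (LBINT v:{0..}. exp (- v) * h v)"
proof -
  have "(\<integral>\<^sup>+v. ennreal (h v) \<partial>density lborel (exponential_density 1))
      = (\<integral>\<^sup>+v. ennreal (indicator {0..} v *\<^sub>R (exp (- v) * h v)) \<partial>lborel)"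
    by (subst nn_integral_density)
       (auto intro!: nn_integral_cong simp: exponential_density_def indicator_def ennreal_mult'[symmetric])
  also have "\<dots> = ennreal (LBINT v:{0..}. exp (- v) * h v)"
    unfolding set_lebesgue_integral_def using int nonneg
    by (intro nn_integral_eq_integral) (auto simp: set_integrable_def indicator_def)
  finally show ?thesis .
qed

lemma exponential_law_laplace:
  assumes "0 \<le> l" "0 \<le> s"
  shows "(\<integral>\<^sup>+v. ennreal (exp (- (l * s / (1 + l * v))) / (1 + l * v)) \<partial>density lborel (exponential_density 1))
    = ennreal (mixed_laplace l 0 s)"
proof -
  have "(\<integral>\<^sup>+v. ennreal (exp (- (l * s / (1 + l * v))) / (1 + l * v)) \<partial>density lborel (exponential_density 1))
    = ennreal (LBINT v:{0..}. exp (- v) * (exp (- (l * s / (1 + l * v))) / (1 + l * v)))"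
    by (rule nn_integral_exponential) (use assms mixed_laplace_integrable[OF assms(1), of 0 s] in simp_all)
  then show ?thesis by (simp add: mixed_laplace_def)
qed

text \<open>Uniqueness of transforms replaces polar coordinates: at n both sides give 1 / (1 + n),
  on the left by the Gaussian formula with mean 0 and scale 1.\<close>

lemma (in prob_space) circular_complex_gaussian_power_law:
  assumes Z: "circular_complex_gaussian M 1 Z"
  shows "distr M borel (\<lambda>\<omega>. (cmod (Z \<omega>))\<^sup>2) = density lborel (exponential_density 1)"
proof (rule laplace_transform_unique_nn_integral)
  have [measurable]: "Z \<in> borel_measurable M"
    using Z by (simp add: circular_complex_gaussian_def)
  show "real_distribution (distr M borel (\<lambda>\<omega>. (cmod (Z \<omega>))\<^sup>2))"
    by (rule real_distribution_distr) simp
  show "AE x in distr M borel (\<lambda>\<omega>. (cmod (Z \<omega>))\<^sup>2). 0 \<le> x"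
    by (subst AE_distr_iff) auto
  show "real_distribution (density lborel (exponential_density 1))"
    by (intro real_distribution.intro prob_space_exponential_density real_distribution_axioms.intro) simp_all
  show "AE x in density lborel (exponential_density 1). 0 \<le> x"
    by (subst AE_density) (auto simp: exponential_density_def)
  show "(\<integral>\<^sup>+x. ennreal (exp (- (real n * x))) \<partial>distr M borel (\<lambda>\<omega>. (cmod (Z \<omega>))\<^sup>2))
      = (\<integral>\<^sup>+x. ennreal (exp (- (real n * x))) \<partial>density lborel (exponential_density 1))" for n
  proof -
    have prod: "exp (- v) * exp (- (real n * v)) = exp (- ((1 + real n) * v))" for v
      by (simp add: exp_add[symmetric] algebra_simps)
    have int: "set_integrable lborel {0..} (\<lambda>v. exp (- v) * exp (- (real n * v)))"
      by (rule set_integrable_bound[OF set_integrable_exp_neg_atLeast]) (auto simp: set_borel_measurable_def)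
    have "(LBINT v:{0..}. exp (- v) * exp (- (real n * v)))
        = 0 - (- exp (- ((1 + real n) * 0)) / (1 + real n))"
    proof (rule set_integral_FTC_atLeast[OF int])
      show "((\<lambda>v. - exp (- ((1 + real n) * v)) / (1 + real n)) has_real_derivative exp (- x) * exp (- (real n * x))) (at x)" for x
        unfolding prod by (auto intro!: derivative_eq_intros simp: add_pos_nonneg less_imp_neq[symmetric] field_simps)
      have "filterlim (\<lambda>v. - ((1 + real n) * v)) at_bot at_top"
        using filterlim_tendsto_pos_mult_at_top[OF tendsto_const _ filterlim_ident, of "1 + real n"]
        by (auto simp: filterlim_uminus_at_bot)
      then have "((\<lambda>v. exp (- ((1 + real n) * v))) \<longlongrightarrow> 0) at_top"
        by (rule filterlim_compose[OF exp_at_bot])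
      then show "((\<lambda>v. - exp (- ((1 + real n) * v)) / (1 + real n)) \<longlongrightarrow> 0) at_top"
        using tendsto_minus by (intro tendsto_divide_zero) fastforce
    qed (intro continuous_intros)
    then have "(\<integral>\<^sup>+x. ennreal (exp (- (real n * x))) \<partial>density lborel (exponential_density 1)) = ennreal (1 / (1 + real n))"
      using nn_integral_exponential[OF _ _ int] by simp
    then show ?thesis
      using circular_complex_gaussian_laplace[OF Z, of "real n" 0 1] by (simp add: nn_integral_distr)
  qed
qed

section \<open>The DRLOS channel\<close>

text \<open>The halves undo the factor 2 in \<open>macdonald\<close>, which normalizes the Wronskian
  to 1.\<close>

lemma bessel_eq_series_macdonald:
  assumes "0 < s"
  shows "bessel_I 0 (2 * sqrt s) = bessel_series 0 s" "bessel_I 1 (2 * sqrt s) = sqrt s * bessel_series 1 s"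
    "bessel_K 0 (2 * sqrt s) = macdonald 0 s / 2" "bessel_K 1 (2 * sqrt s) = sqrt s * macdonald 1 s / 2"
  using bessel_I_eq_series[OF assms, of 0] bessel_I_eq_series[OF assms, of 1] assms
  by (simp_all add: bessel_K_eq_cosh macdonald_def)

context sosf_channel
begin

text \<open>\<open>indep_var\<close> wants both variables of the same type, hence the dummy component next to \<open>G3\<close>.\<close>

lemma indep_phase_G2_G3:
  "indep_var (borel \<Otimes>\<^sub>M borel) (\<lambda>\<omega>. (complex_of_real (\<phi> \<omega>), G2 \<omega>))
    (borel \<Otimes>\<^sub>M borel) (\<lambda>\<omega>. (0 :: complex, G3 \<omega>))"
proof -
  let ?V = "\<lambda>i. [\<lambda>x. complex_of_real (\<phi> x), G1, G2, G3] ! i"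
  have "indep_var (PiM {0, 2} (\<lambda>_. borel)) (\<lambda>\<omega>. restrict (\<lambda>i. ?V i \<omega>) {0, 2})
      (PiM {3} (\<lambda>_. borel)) (\<lambda>\<omega>. restrict (\<lambda>i. ?V i \<omega>) {3})"
    by (rule indep_var_restrict[OF independent]) auto
  then have "indep_var (borel \<Otimes>\<^sub>M borel) ((\<lambda>f. (f 0, f 2)) \<circ> (\<lambda>\<omega>. restrict (\<lambda>i. ?V i \<omega>) {0, 2}))
      (borel \<Otimes>\<^sub>M borel) ((\<lambda>f. (0, f 3)) \<circ> (\<lambda>\<omega>. restrict (\<lambda>i. ?V i \<omega>) {3}))"
    by (rule indep_var_compose) measurable
  then show ?thesis by (simp add: o_def numeral_2_eq_2 numeral_3_eq_3)
qed

lemma signal_measurable: "sosf_signal \<omega>0 \<omega>1 \<omega>2 \<phi> G1 G2 G3 \<in> borel_measurable M"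
proof -
  have [measurable]: "\<phi> \<in> borel_measurable M" "G1 \<in> borel_measurable M"
      "G2 \<in> borel_measurable M" "G3 \<in> borel_measurable M"
    using phase_measurable gaussian by (simp_all add: circular_complex_gaussian_def)
  show ?thesis unfolding sosf_signal_def[abs_def] by measurable
qed

text \<open>Given \<open>G2\<close>, the signal is a complex Gaussian around a point of modulus \<open>\<omega>0\<close>; its Laplace
  transform does not see the phase.\<close>

lemma drlos_laplace:
  assumes "\<omega>1 = 0" "0 \<le> l"
  shows "(\<integral>\<^sup>+\<omega>. ennreal (exp (- (l * (cmod (sosf_signal \<omega>0 \<omega>1 \<omega>2 \<phi> G1 G2 G3 \<omega>))\<^sup>2))) \<partial>M)
    = (\<integral>\<^sup>+v. ennreal (exp (- (l * \<omega>0\<^sup>2 / (1 + l * \<omega>2\<^sup>2 * v))) / (1 + l * \<omega>2\<^sup>2 * v))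
        \<partial>density lborel (exponential_density 1))"
proof -
  have [measurable]: "G2 \<in> borel_measurable M"
    using gaussian by (simp add: circular_complex_gaussian_def)
  define h where "h z = ennreal (exp (- (l * (cmod (of_real \<omega>0 * exp (\<i> * fst (fst z))
      + (of_real \<omega>2 * snd (fst z)) * snd (snd z)))\<^sup>2)))" for z :: "(complex \<times> complex) \<times> (complex \<times> complex)"
  have [measurable]: "h \<in> borel_measurable ((borel \<Otimes>\<^sub>M borel) \<Otimes>\<^sub>M (borel \<Otimes>\<^sub>M borel))"
    unfolding h_def[abs_def] by measurable
  have "(\<integral>\<^sup>+\<omega>. ennreal (exp (- (l * (cmod (sosf_signal \<omega>0 \<omega>1 \<omega>2 \<phi> G1 G2 G3 \<omega>))\<^sup>2))) \<partial>M)
      = (\<integral>\<^sup>+\<omega>. h ((complex_of_real (\<phi> \<omega>), G2 \<omega>), (0, G3 \<omega>)) \<partial>M)"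
    by (simp add: h_def sosf_signal_def assms)
  also have "\<dots> = (\<integral>\<^sup>+\<omega>. \<integral>\<^sup>+\<omega>'. h ((complex_of_real (\<phi> \<omega>), G2 \<omega>), (0, G3 \<omega>')) \<partial>M \<partial>M)"
    by (rule indep_var_nn_integral_iterated[OF indep_phase_G2_G3]) simp
  also have "\<dots> = (\<integral>\<^sup>+\<omega>. ennreal (exp (- (l * \<omega>0\<^sup>2 / (1 + l * \<omega>2\<^sup>2 * (cmod (G2 \<omega>))\<^sup>2)))
      / (1 + l * \<omega>2\<^sup>2 * (cmod (G2 \<omega>))\<^sup>2)) \<partial>M)"
    \<comment> \<open>With phase and \<open>G2\<close> frozen, \<open>G3\<close> is scaled by
      \<omega>2 \<open>G2\<close> and shifted by a point of modulus \<omega>0. Only these moduli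
      survive, so the phase disappears.\<close>
    unfolding h_def fst_conv snd_conv circular_complex_gaussian_laplace[OF gaussian(3) assms(2)]
    by (simp add: norm_mult power_mult_distrib mult.assoc)
  also have "\<dots> = (\<integral>\<^sup>+v. ennreal (exp (- (l * \<omega>0\<^sup>2 / (1 + l * \<omega>2\<^sup>2 * v))) / (1 + l * \<omega>2\<^sup>2 * v))
      \<partial>distr M borel (\<lambda>\<omega>. (cmod (G2 \<omega>))\<^sup>2))"
    by (simp add: nn_integral_distr)
  finally show ?thesis
    by (simp only: circular_complex_gaussian_power_law[OF gaussian(2)])
qed

lemma drlos_distr:
  assumes "\<omega>1 = 0" "\<omega>0\<^sup>2 = \<beta>" "\<omega>2\<^sup>2 = 1 - \<beta>" "0 < \<beta>" "\<beta> < 1"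
  shows "distr M borel (\<lambda>\<omega>. (cmod (sosf_signal \<omega>0 \<omega>1 \<omega>2 \<phi> G1 G2 G3 \<omega>))\<^sup>2 / (1 - \<beta>))
    = drlos_law (\<beta> / (1 - \<beta>))"
proof (rule laplace_transform_unique_nn_integral)
  let ?X = "\<lambda>\<omega>. (cmod (sosf_signal \<omega>0 \<omega>1 \<omega>2 \<phi> G1 G2 G3 \<omega>))\<^sup>2 / (1 - \<beta>)"
  note signal_measurable[measurable]
  show "real_distribution (distr M borel ?X)"
    by (rule real_distribution_distr) simp
  show "AE x in distr M borel ?X. 0 \<le> x"
  proof -
    have X: "?X \<in> borel_measurable M" by measurable
    show ?thesis by (subst AE_distr_iff[OF X]) (use assms in auto)
  qed
  show "real_distribution (drlos_law (\<beta> / (1 - \<beta>)))" "AE x in drlos_law (\<beta> / (1 - \<beta>)). 0 \<le> x"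
    using assms by (auto intro!: drlos_law_real_distribution drlos_law_AE_nonneg)
  show "(\<integral>\<^sup>+x. ennreal (exp (- (real n * x))) \<partial>distr M borel ?X)
      = (\<integral>\<^sup>+x. ennreal (exp (- (real n * x))) \<partial>drlos_law (\<beta> / (1 - \<beta>)))" for n
  proof -
    have "(\<integral>\<^sup>+x. ennreal (exp (- (real n * x))) \<partial>distr M borel ?X)
        = (\<integral>\<^sup>+\<omega>. ennreal (exp (- (real n / (1 - \<beta>) * (cmod (sosf_signal \<omega>0 \<omega>1 \<omega>2 \<phi> G1 G2 G3 \<omega>))\<^sup>2))) \<partial>M)"
      by (simp add: nn_integral_distr)
    \<comment> \<open>At l = n / (1 - \<beta>) one has l \<omega>2^2 = n and l \<omega>0^2 = n
      \<beta> / (1 - \<beta>), the parameters of the exponential average.\<close>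
    also have "\<dots> = (\<integral>\<^sup>+v. ennreal (exp (- (real n * (\<beta> / (1 - \<beta>)) / (1 + real n * v))) / (1 + real n * v))
        \<partial>density lborel (exponential_density 1))"
      using assms by (subst drlos_laplace) simp_all
    also have "\<dots> = ennreal (mixed_laplace (real n) 0 (\<beta> / (1 - \<beta>)))"
      using assms by (intro exponential_law_laplace) auto
    also have "\<dots> = (\<integral>\<^sup>+x. ennreal (exp (- (real n * x))) \<partial>drlos_law (\<beta> / (1 - \<beta>)))"
      using assms by (intro drlos_law_laplace[symmetric]) auto
    finally show ?thesis .
  qed
qed

lemma drlos_snr_cdf:
  assumes "\<omega>1 = 0" "\<omega>0\<^sup>2 = \<beta>" "\<omega>2\<^sup>2 = 1 - \<beta>" "0 < \<beta>" "\<beta> < 1" "0 < \<gamma>bar"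
  shows "cdf (distr M borel (instantaneous_snr \<gamma>bar (sosf_signal \<omega>0 \<omega>1 \<omega>2 \<phi> G1 G2 G3))) x
    = cdf (drlos_law (\<beta> / (1 - \<beta>))) (x / \<gamma>bar / (1 - \<beta>))"
proof -
  note signal_measurable[measurable]
  have eq: "\<gamma>bar * (cmod (sosf_signal \<omega>0 \<omega>1 \<omega>2 \<phi> G1 G2 G3 \<omega>))\<^sup>2 \<le> x \<longleftrightarrow>
      (cmod (sosf_signal \<omega>0 \<omega>1 \<omega>2 \<phi> G1 G2 G3 \<omega>))\<^sup>2 / (1 - \<beta>) \<le> x / \<gamma>bar / (1 - \<beta>)" for \<omega>
    using assms by (simp add: divide_le_cancel pos_le_divide_eq mult.commute)
  have [measurable]: "instantaneous_snr \<gamma>bar (sosf_signal \<omega>0 \<omega>1 \<omega>2 \<phi> G1 G2 G3) \<in> borel_measurable M"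
    unfolding instantaneous_snr_def[abs_def] by measurable
  show ?thesis
    unfolding drlos_distr[OF assms(1-5), symmetric] cdf_def
    by (simp add: measure_distr vimage_def instantaneous_snr_def eq)
qed

end

theorem mainTheorem9:
  fixes M :: "'a measure"
    and \<beta> \<gamma>bar \<omega>0 \<omega>1 \<omega>2 :: real
    and \<phi> :: "'a \<Rightarrow> real"
    and G1 G2 G3 :: "'a \<Rightarrow> complex"
    and \<gamma> :: "'a \<Rightarrow> real"
  assumes "0 < \<gamma>bar" and "0 < \<beta>" and "\<beta> < 1"
    and "drlos_channel M \<beta> \<omega>0 \<omega>1 \<omega>2 \<phi> G1 G2 G3"
    and "\<gamma> = instantaneous_snr \<gamma>bar (sosf_signal \<omega>0 \<omega>1 \<omega>2 \<phi> G1 G2 G3)"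
  shows
    "(\<forall>x. 0 < x \<and> x < \<beta> * \<gamma>bar \<longrightarrow>
        cdf (distr M borel \<gamma>) x =
          2 / sqrt (1 - \<beta>) * bessel_K 0 (2 * sqrt (\<beta> / (1 - \<beta>))) * sqrt (x / \<gamma>bar)
            * bessel_I 1 (2 * sqrt ((x / \<gamma>bar) / (1 - \<beta>)))) \<and>
     (let c = 2 * sqrt (\<beta> / (1 - \<beta>)) * bessel_K 0 (2 * sqrt (\<beta> / (1 - \<beta>)))
                * bessel_I 1 (2 * sqrt (\<beta> / (1 - \<beta>)))
      in \<forall>x. x > \<beta> * \<gamma>bar \<longrightarrow>
        cdf (distr M borel \<gamma>) x =
          c + 2 / sqrt (1 - \<beta>) * bessel_I 0 (2 * sqrt (\<beta> / (1 - \<beta>)))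
            * (sqrt \<beta> * bessel_K 1 (2 * sqrt (\<beta> / (1 - \<beta>)))
               - sqrt (x / \<gamma>bar) * bessel_K 1 (2 * sqrt ((x / \<gamma>bar) / (1 - \<beta>)))))"
proof -
  interpret sosf_channel M \<omega>0 \<omega>1 \<omega>2 \<phi> G1 G2 G3
    using assms(4) by (simp add: drlos_channel_def)
  have \<omega>: "\<omega>0\<^sup>2 = \<beta>" "\<omega>2\<^sup>2 = 1 - \<beta>"
    using assms(4) by (simp_all add: drlos_channel_def sosf_alpha_def sosf_beta_def)
  then have "\<omega>1 = 0" using weights_normalized by simp
  define b where "b = \<beta> / (1 - \<beta>)"
  define u where "u x = x / \<gamma>bar / (1 - \<beta>)" for x
  have b: "0 < b" using assms by (simp add: b_def)
  have cdf: "cdf (distr M borel \<gamma>) x = cdf (drlos_law b) (u x)" for x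
    unfolding assms(5) b_def u_def by (rule drlos_snr_cdf[OF \<open>\<omega>1 = 0\<close> \<omega> assms(2,3,1)])
  \<comment> \<open>In units of 1 - \<beta> every square root outside a Bessel function carries a
    factor sqrt (1 - \<beta>), which cancels the prefactor 2 / sqrt (1 - \<beta>) up to 2.\<close>
  have roots: "sqrt (x / \<gamma>bar) = sqrt (1 - \<beta>) * sqrt (u x)" "sqrt \<beta> = sqrt (1 - \<beta>) * sqrt b" for x
    using assms by (simp_all add: u_def b_def real_sqrt_divide real_sqrt_mult)
  have scale: "2 / sqrt (1 - \<beta>) * y * (sqrt (1 - \<beta>) * z) = 2 * y * z" for y z
    using assms by simp
  have I: "cdf (distr M borel \<gamma>) x = 2 / sqrt (1 - \<beta>) * bessel_K 0 (2 * sqrt b) * sqrt (x / \<gamma>bar)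
      * bessel_I 1 (2 * sqrt (u x))" if "0 < x" "x < \<beta> * \<gamma>bar" for x
  proof -
    have u: "0 < u x" "u x < b"
      using that assms by (simp_all add: u_def b_def divide_strict_right_mono pos_divide_less_eq)
    then show ?thesis
      unfolding roots cdf scale
      by (simp add: drlos_law_cdf(1)[OF b] bessel_eq_series_macdonald b del: One_nat_def)
  qed
  have K: "cdf (distr M borel \<gamma>) x = 2 * sqrt b * bessel_K 0 (2 * sqrt b) * bessel_I 1 (2 * sqrt b)
      + 2 / sqrt (1 - \<beta>) * bessel_I 0 (2 * sqrt b)
        * (sqrt \<beta> * bessel_K 1 (2 * sqrt b) - sqrt (x / \<gamma>bar) * bessel_K 1 (2 * sqrt (u x)))"
    if "\<beta> * \<gamma>bar < x" for x
  proof -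
    have "b < u x"
      using that assms by (simp add: u_def b_def divide_strict_right_mono pos_less_divide_eq)
    moreover from this b have "0 < u x" by simp
    \<comment> \<open>One sqrt y is the explicit factor, the other comes from a Bessel function of
      order 1. Their product is the y in the antiderivatives.\<close>
    have sq: "sqrt y * (sqrt y * z) = y * z" "sqrt y * w * (sqrt y * z) = w * (y * z)"
      if "0 < y" for w y z :: real
      using that by (simp_all add: mult_ac)
    ultimately show ?thesis
      unfolding roots cdf mult.assoc[of "sqrt (1 - \<beta>)"] right_diff_distrib[symmetric] scale
      using b
      by (simp add: drlos_law_cdf(2)[OF b] bessel_eq_series_macdonald sq right_diff_distrib del: One_nat_def)
  qed
  show ?thesis
    using I K unfolding Let_def b_def u_def by blast
qed

end
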